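(* Suppose that an indeterminate normalized Hamburger moment problem (of order zero) has logarithmic order zero. Let $c_k=\big(\sum_{n=k}^\infty b_{k,n}^2\big)^{1/2}$, where $b_{k,n}$ is the coefficient of $x^k$ in the orthonormal polynomial $P_n$, and let $\Phi(z)=\sum_{k=0}^\infty c_kz^k$ (an entire function). Then $\Phi$ has the same double logarithmic order $\rho^{[2]}$ and double logarithmic type $\tau^{[2]}$ as the moment problem (the statement about type being understood when $0<\rho^{[2]}<\infty$, so that type is defined).
   Context: A normalized Hamburger moment problem is given by a sequence $s_n=\int_{-\infty}^\infty x^n\,d\mu(x)$, $n\ge0$, where $\mu$ is a probability measure on $\mathbb R$ with infinite support and moments of every order. It is indeterminate if more than one measure $\mu$ has these moments. Let $P_n(x)=\sum_{k=0}^n b_{k,n}x^k$ be the orthonormal polynomials (positive leading coefficients) and $P(z)=(\sum_{n\ge0}|P_n(z)|^2)^{1/2}$; in the indeterminate case $P$ is finite and continuous on $\mathbb C$. It is known that in the indeterminate case the $c_k$ are finite and $\lim_k k\,c_k^{1/k}=0$, so $\Phi$ is entire. For an unbounded continuous $f:\mathbb C\to\mathbb C$ let $M_f(r)=\max_{|z|\le r}|f(z)|$. The logarithmic order is $\rho^{[1]}_f=\inf\{a>0\mid M_f(r)\le r^{(\log r)^a}\text{ for all large }r\}$ (finite only for functions of ordinary order $0$). The double logarithmic order is $\rho^{[2]}_f=\inf\{a>0\mid M_f(r)\le r^{(\log\log r)^a}\text{ for all large }r\}\in[0,\infty]$ ($\inf\emptyset=\infty$). If $0<\rho^{[2]}_f<\infty$,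 the double logarithmic type is $\tau^{[2]}_f=\inf\{c>0\mid M_f(r)\le r^{c(\log\log r)^{\rho^{[2]}_f}}\text{ for all large }r\}$ ($\inf\emptyset=\infty$). Let $Q_n$ be the polynomials of the second kind, $Q(z)=(\sum_n|Q_n(z)|^2)^{1/2}$, and let $A(z)=z\sum_k Q_k(0)Q_k(z)$, $B(z)=-1+z\sum_k Q_k(0)P_k(z)$, $C(z)=1+z\sum_k P_k(0)Q_k(z)$, $D(z)=z\sum_k P_k(0)P_k(z)$. For an indeterminate problem of order zero the six functions $A,B,C,D,P,Q$ have the same logarithmic order (the logarithmic order of the moment problem), and if it is zero they have the same double logarithmic order and type, called the double logarithmic order $\rho^{[2]}$ and type $\tau^{[2]}$ of the moment problem. *)

theory Defs
  imports "HOL-Probability.Probability" "HOL-Computational_Algebra.Polynomial"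
begin

section \<open>Moment problems and orthonormal polynomials\<close>

definition solves_moment_problem :: "(nat \<Rightarrow> real) \<Rightarrow> real measure \<Rightarrow> bool" where
  "solves_moment_problem s \<mu> \<longleftrightarrow>
     sets \<mu> = sets borel \<and> (\<forall>n. integrable \<mu> (\<lambda>x. x ^ n) \<and> s n = (\<integral>x. x ^ n \<partial>\<mu>))"

definition measure_support :: "real measure \<Rightarrow> real set" where
  "measure_support \<mu> = {x. \<forall>U. open U \<and> x \<in> U \<longrightarrow> emeasure \<mu> U > 0}"

text \<open>The moment sequence \<open>s\<close> is normalized (\<open>s 0 = 1\<close>) because \<open>\<mu>\<close> is a probability measure.\<close>

definition normalized_hamburger :: "(nat \<Rightarrow> real) \<Rightarrow> real measure \<Rightarrow> bool" where
  "normalized_hamburger s \<mu> \<longleftrightarrow>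
     prob_space \<mu> \<and> solves_moment_problem s \<mu> \<and> infinite (measure_support \<mu>)"

definition indeterminate :: "(nat \<Rightarrow> real) \<Rightarrow> bool" where
  "indeterminate s \<longleftrightarrow>
     (\<exists>\<mu> \<nu>. solves_moment_problem s \<mu> \<and> solves_moment_problem s \<nu> \<and> \<mu> \<noteq> \<nu>)"

text \<open>For \<open>\<mu>\<close> with infinite support these conditions determine the sequence \<open>p\<close> uniquely.\<close>

definition orthonormal_polys :: "real measure \<Rightarrow> (nat \<Rightarrow> real poly) \<Rightarrow> bool" where
  "orthonormal_polys \<mu> p \<longleftrightarrow>
     (\<forall>n. degree (p n) = n \<and> lead_coeff (p n) > 0) \<and>
     (\<forall>m n. (\<integral>x. poly (p m) x * poly (p n) x \<partial>\<mu>) = of_bool (m = n))"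

definition polyP :: "(nat \<Rightarrow> real poly) \<Rightarrow> nat \<Rightarrow> complex \<Rightarrow> complex" where
  "polyP p n z = poly (map_poly of_real (p n)) z"

text \<open>
  The polynomials of the second kind are \<open>Q\<^sub>n(z) = \<integral> (P\<^sub>n(z) - P\<^sub>n(x)) / (z - x) d\<mu>(x)\<close>.
  The difference quotient is a polynomial in \<open>z\<close>, namely the one given by
  \<^const>\<open>synthetic_div\<close>; this gives the right value also at \<open>z = x\<close>, where \<open>\<mu>\<close> may have an atom.
\<close>

definition polyQ :: "real measure \<Rightarrow> (nat \<Rightarrow> real poly) \<Rightarrow> nat \<Rightarrow> complex \<Rightarrow> complex" where
  "polyQ \<mu> p n z = (\<integral>x. poly (synthetic_div (map_poly of_real (p n)) (of_real x)) z \<partial>\<mu>)"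

section \<open>The functions of the moment problem\<close>

text \<open>The series converge for every \<open>z\<close> in the indeterminate case.
  The real-valued functions \<open>P\<close> and \<open>Q\<close> are embedded into the complex numbers.\<close>

definition fnP :: "(nat \<Rightarrow> real poly) \<Rightarrow> complex \<Rightarrow> complex" where
  "fnP p z = of_real (sqrt (\<Sum>n. (norm (polyP p n z))\<^sup>2))"

definition fnQ :: "real measure \<Rightarrow> (nat \<Rightarrow> real poly) \<Rightarrow> complex \<Rightarrow> complex" where
  "fnQ \<mu> p z = of_real (sqrt (\<Sum>n. (norm (polyQ \<mu> p n z))\<^sup>2))"

definition fnA :: "real measure \<Rightarrow> (nat \<Rightarrow> real poly) \<Rightarrow> complex \<Rightarrow> complex" where
  "fnA \<mu> p z = z * (\<Sum>k. polyQ \<mu> p k 0 * polyQ \<mu> p k z)"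

definition fnB :: "real measure \<Rightarrow> (nat \<Rightarrow> real poly) \<Rightarrow> complex \<Rightarrow> complex" where
  "fnB \<mu> p z = -1 + z * (\<Sum>k. polyQ \<mu> p k 0 * polyP p k z)"

definition fnC :: "real measure \<Rightarrow> (nat \<Rightarrow> real poly) \<Rightarrow> complex \<Rightarrow> complex" where
  "fnC \<mu> p z = 1 + z * (\<Sum>k. polyP p k 0 * polyQ \<mu> p k z)"

definition fnD :: "(nat \<Rightarrow> real poly) \<Rightarrow> complex \<Rightarrow> complex" where
  "fnD p z = z * (\<Sum>k. polyP p k 0 * polyP p k z)"

definition moment_functions ::
    "real measure \<Rightarrow> (nat \<Rightarrow> real poly) \<Rightarrow> (complex \<Rightarrow> complex) set" where
  "moment_functions \<mu> p = {fnA \<mu> p, fnB \<mu> p, fnC \<mu> p, fnD p, fnP p, fnQ \<mu> p}"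

text \<open>Reindexed by \<open>n = k + j\<close>; \<open>coeff (p n) k\<close> is the coefficient \<open>b\<^sub>k\<^sub>,\<^sub>n\<close>.\<close>

definition coeff_norm :: "(nat \<Rightarrow> real poly) \<Rightarrow> nat \<Rightarrow> real" where
  "coeff_norm p k = sqrt (\<Sum>j. (coeff (p (k + j)) k)\<^sup>2)"

definition fnPhi :: "(nat \<Rightarrow> real poly) \<Rightarrow> complex \<Rightarrow> complex" where
  "fnPhi p z = (\<Sum>k. of_real (coeff_norm p k) * z ^ k)"

section \<open>Growth\<close>

text \<open>For continuous \<open>f\<close> and \<open>r \<ge> 0\<close> the supremum is a maximum.\<close>

definition max_mod :: "(complex \<Rightarrow> complex) \<Rightarrow> real \<Rightarrow> real" where
  "max_mod f r = (SUP z\<in>cball 0 r. norm (f z))"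

text \<open>All infima are taken in \<^typ>\<open>ereal\<close>, so that the infimum of the empty set is \<open>\<infinity>\<close>.\<close>

definition growth_order :: "(complex \<Rightarrow> complex) \<Rightarrow> ereal" where
  "growth_order f =
     Inf (ereal ` {a. a > 0 \<and> (\<forall>\<^sub>F r in at_top. max_mod f r \<le> exp (r powr a))})"

definition log_order :: "(complex \<Rightarrow> complex) \<Rightarrow> ereal" where
  "log_order f =
     Inf (ereal ` {a. a > 0 \<and> (\<forall>\<^sub>F r in at_top. max_mod f r \<le> r powr (ln r powr a))})"

definition dlog_order :: "(complex \<Rightarrow> complex) \<Rightarrow> ereal" where
  "dlog_order f =
     Inf (ereal ` {a. a > 0 \<and> (\<forall>\<^sub>F r in at_top. max_mod f r \<le> r powr (ln (ln r) powr a))})"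

text \<open>Meaningful only if \<open>0 < dlog_order f < \<infinity>\<close>.\<close>

definition dlog_type :: "(complex \<Rightarrow> complex) \<Rightarrow> ereal" where
  "dlog_type f =
     Inf (ereal ` {c. c > 0 \<and> (\<forall>\<^sub>F r in at_top.
       max_mod f r \<le> r powr (c * ln (ln r) powr real_of_ereal (dlog_order f)))})"

text \<open>
  A moment problem has order (logarithmic order, double logarithmic order, type) \<open>v\<close> if \<open>v\<close> is
  the common value of that quantity for all six functions \<open>A, B, C, D, P, Q\<close>.
\<close>

definition problem_has ::
    "((complex \<Rightarrow> complex) \<Rightarrow> ereal) \<Rightarrow> real measure \<Rightarrow> (nat \<Rightarrow> real poly) \<Rightarrow> ereal \<Rightarrow> bool" where
  "problem_has \<omega> \<mu> p v \<longleftrightarrow> (\<forall>f\<in>moment_functions \<mu> p. \<omega> f = v)"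

end

theory Submission
  imports Defs "HOL-Complex_Analysis.Complex_Analysis" "HOL-Real_Asymp.Real_Asymp"
begin

text \<open>
  Double logarithmic order and type do not see a factor \<open>C r\<^sup>m\<close> or a rescaling \<open>r \<mapsto> K r\<close>, so it is
  enough to compare all maximum moduli up to such changes.

  By Minkowski and Cauchy's coefficient estimate, \<open>M\<^sub>P(r) \<le> M\<^sub>\<Phi>(r) \<le> 2 M\<^sub>P(2r)\<close>.
  By Cauchy--Schwarz, \<open>B, D\<close> are bounded by \<open>O(r) P\<close>, and \<open>A, C\<close> by \<open>O(r) Q\<close>. Conversely the
  Christoffel--Darboux identity \<open>(z - w) \<Sum> P\<^sub>n(z) P\<^sub>n(w) = B(z) D(w) - D(z) B(w)\<close> at \<open>w = cnj z\<close>
  gives \<open>\<bar>Im z\<bar> P(z) \<le> O(r) M\<^sub>D(r)\<close>, and likewise for \<open>B\<close> and for \<open>Q\<close> against \<open>A, C\<close>; the maximum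
  principle removes the factor \<open>\<bar>Im z\<bar>\<close> at the cost of doubling the radius. Finally, Bessel's
  inequality for \<open>x \<mapsto> 1/(x - z)\<close> in \<open>L\<^sup>2(\<mu>)\<close> compares \<open>P\<close> with \<open>Q\<close> off the real axis.

  Convergence of the series: two solutions have different Cauchy transforms at some nonreal point, and
  Bessel's inequality for both of them gives square summability of \<open>P\<^sub>n\<close> and \<open>Q\<^sub>n\<close> there; expanding
  around that point and a discrete Gronwall argument make it locally uniform on the plane.
\<close>

section \<open>Comparison of growth\<close>

text \<open>The condition \<open>K \<ge> 1\<close> keeps \<open>K * r\<close> in the range of radii
  at least 1 for which the bound is stated, so that two such estimates compose.\<close>

definition growth_le :: "(complex \<Rightarrow> complex) \<Rightarrow> (complex \<Rightarrow> complex) \<Rightarrow> bool" where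
  "growth_le f g \<longleftrightarrow>
     (\<exists>C m K. C > 0 \<and> K \<ge> 1 \<and> (\<forall>r\<ge>1. max_mod f r \<le> C * r ^ m * max_mod g (K * r)))"

lemma growth_leI:
  assumes "C > 0" "K \<ge> 1" "\<And>r. r \<ge> 1 \<Longrightarrow> max_mod f r \<le> C * r ^ m * max_mod g (K * r)"
  shows "growth_le f g"
  using assms unfolding growth_le_def by blast

lemma growth_le_trans [trans]:
  assumes "growth_le f g" "growth_le g h"
  shows "growth_le f h"
proof -
  obtain C m K where 1: "C > 0" "K \<ge> 1" "\<And>r. r \<ge> 1 \<Longrightarrow> max_mod f r \<le> C * r ^ m * max_mod g (K * r)"
    using assms(1) unfolding growth_le_def by blast
  obtain C' m' K' where 2: "C' > 0" "K' \<ge> 1"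
    "\<And>r. r \<ge> 1 \<Longrightarrow> max_mod g r \<le> C' * r ^ m' * max_mod h (K' * r)"
    using assms(2) unfolding growth_le_def by blast
  show ?thesis
  proof (rule growth_leI)
    show "C * C' * K ^ m' > 0" using 1 2 by simp
    show "K' * K \<ge> 1" using mult_mono[of 1 K' 1 K] 1 2 by simp
    fix r :: real assume r: "r \<ge> 1"
    have Kr: "K * r \<ge> 1" using mult_mono[of 1 K 1 r] 1 r by simp
    have "max_mod f r \<le> C * r ^ m * max_mod g (K * r)" using 1 r by blast
    also have "\<dots> \<le> C * r ^ m * (C' * (K * r) ^ m' * max_mod h (K' * (K * r)))"
      using 2(3)[OF Kr] 1 r by (intro mult_left_mono) auto
    also have "\<dots> = C * C' * K ^ m' * r ^ (m + m') * max_mod h (K' * K * r)"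
      by (simp add: power_mult_distrib power_add mult_ac)
    finally show "max_mod f r \<le> C * C' * K ^ m' * r ^ (m + m') * max_mod h (K' * K * r)" .
  qed
qed

text \<open>The logarithm of the left side is asymptotic to
  \<open>c * ln r * ln (ln r) powr a\<close>: since \<open>a > 0\<close>, the terms
  \<open>ln C + m * ln r\<close> are of smaller order, and \<open>ln (K * r)\<close> is asymptotic
  to \<open>ln r\<close>. Any strict increase of the exponent, or of the constant at the same
  exponent, absorbs the difference. The first alternative serves the order, the second the
  type.\<close>

lemma rescaled_growth_absorbed:
  fixes C K c c' a a' :: real
  assumes "C > 0" "K \<ge> 1" "a > 0" "c > 0" "c' > 0" and less: "a < a' \<or> a = a' \<and> c < c'"
  shows "\<forall>\<^sub>F r in at_top.
    C * r ^ m * (K * r) powr (c * ln (ln (K * r)) powr a) \<le> r powr (c' * ln (ln r) powr a')"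
proof -
  define h where "h r = ln C + real m * ln r + ln (K * r) * (c * ln (ln (K * r)) powr a)" for r
  have K: "K > 0" using assms by simp
  have lim: "((\<lambda>r. h r / (ln r * ln (ln r) powr a)) \<longlongrightarrow> c) at_top"
    unfolding h_def using \<open>a > 0\<close> \<open>c > 0\<close> K by real_asymp
  have zero: "((\<lambda>r. c' * ln (ln r) powr (a' - a) - h r / (ln r * ln (ln r) powr a)) \<longlongrightarrow> c' - c) at_top"
    if "a = a'"
  proof -
    have "((\<lambda>r. c' * ln (ln r) powr 0) \<longlongrightarrow> c') at_top" for c' :: real by real_asymp
    from tendsto_diff[OF this lim] show ?thesis using that by simp
  qed
  have pos: "filterlim (\<lambda>r. c' * ln (ln r) powr (a' - a)
      - h r / (ln r * ln (ln r) powr a)) at_top at_top" if "a < a'"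
  proof -
    define d where "d = a' - a"
    have "d > 0" using that d_def by simp
    then have "filterlim (\<lambda>r. c' * ln (ln r) powr d) at_top at_top"
      using \<open>c' > 0\<close> by real_asymp
    from filterlim_tendsto_add_at_top[OF tendsto_minus[OF lim] this]
    show ?thesis unfolding d_def by simp
  qed
  \<comment> \<open>This is the difference of the logarithms of the two sides, divided by
    \<open>ln r * ln (ln r) powr a\<close>. It tends to infinity if \<open>a < a'\<close>, and to
    \<open>c' - c > 0\<close> otherwise.\<close>
  have "\<forall>\<^sub>F r in at_top. c' * ln (ln r) powr (a' - a) - h r / (ln r * ln (ln r) powr a) > 0"
  proof (cases "a < a'")
    case True
    with pos show ?thesis unfolding filterlim_at_top_dense by blast
  next
    case False
    with less have "a = a'" "c' - c > 0" by auto
    then show ?thesis by (intro order_tendstoD(1)[OF zero])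
  qed
  then show ?thesis
    \<comment> \<open>Beyond \<open>exp 1\<close> the iterated logarithm is positive, so the
      division can be undone.\<close>
    using eventually_gt_at_top[of "exp 1 :: real"]
  proof eventually_elim
    case (elim r)
    have r: "r > 0" using elim(2) by (meson exp_gt_zero less_trans)
    have l: "ln r > 1" using ln_less_cancel_iff[of "exp 1" r] elim(2) r by simp
    then have ll: "ln (ln r) > 0" by simp
    have "h r / (ln r * ln (ln r) powr a) < c' * ln (ln r) powr (a' - a)" using elim(1) by simp
    then have "h r < c' * ln (ln r) powr (a' - a) * (ln r * ln (ln r) powr a)"
      using l ll by (simp add: pos_divide_less_eq)
    also have "\<dots> = ln r * (c' * ln (ln r) powr a')"
      using ll by (simp add: powr_diff)
    finally have *: "h r < ln r * (c' * ln (ln r) powr a')" .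
    have "C * r ^ m * (K * r) powr (c * ln (ln (K * r)) powr a) = exp (h r)"
      unfolding h_def using \<open>C > 0\<close> K r
      by (simp add: exp_add powr_def exp_of_nat_mult mult_ac)
    also have "\<dots> \<le> exp (ln r * (c' * ln (ln r) powr a'))" using * by simp
    also have "\<dots> = r powr (c' * ln (ln r) powr a')" using r by (simp add: powr_def mult_ac)
    finally show ?case .
  qed
qed

lemma growth_le_eventually:
  fixes c c' a a' :: real
  assumes fg: "growth_le f g" and "a > 0" "c > 0" "c' > 0" "a < a' \<or> a = a' \<and> c < c'"
    and g: "\<forall>\<^sub>F r in at_top. max_mod g r \<le> r powr (c * ln (ln r) powr a)"
  shows "\<forall>\<^sub>F r in at_top. max_mod f r \<le> r powr (c' * ln (ln r) powr a')"
proof -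
  obtain C m K where 1: "C > 0" "K \<ge> 1" "\<And>r. r \<ge> 1 \<Longrightarrow> max_mod f r \<le> C * r ^ m * max_mod g (K * r)"
    using fg unfolding growth_le_def by blast
  have "filterlim (\<lambda>r. K * r) at_top at_top"
    using 1(2) by (intro filterlim_tendsto_pos_mult_at_top[OF tendsto_const]) (auto simp: filterlim_ident)
  then have "\<forall>\<^sub>F r in at_top. max_mod g (K * r) \<le> (K * r) powr (c * ln (ln (K * r)) powr a)"
    by (rule eventually_compose_filterlim[OF g])
  then show ?thesis
    using rescaled_growth_absorbed[OF 1(1,2) assms(2-5), of m] eventually_ge_at_top[of 1]
  proof eventually_elim
    case (elim r)
    have "max_mod f r \<le> C * r ^ m * max_mod g (K * r)" using 1 elim by blast
    also have "\<dots> \<le> C * r ^ m * (K * r) powr (c * ln (ln (K * r)) powr a)"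
      using elim 1 by (intro mult_left_mono) auto
    finally show ?case using elim by linarith
  qed
qed

text \<open>An arbitrarily small loss is invisible to an infimum. The hypothesis asks only for
  \<open>b\<close> strictly above \<open>a\<close> because the growth comparison has to raise the
  exponent or the constant strictly.\<close>

lemma Inf_ereal_image_mono:
  assumes "\<And>a b :: real. a \<in> A \<Longrightarrow> a < b \<Longrightarrow> b \<in> B"
  shows "Inf (ereal ` B) \<le> Inf (ereal ` A)"
proof (rule Inf_greatest)
  fix x assume "x \<in> ereal ` A"
  then obtain a where a: "a \<in> A" "x = ereal a" by blast
  show "Inf (ereal ` B) \<le> x"
  proof (rule ereal_le_epsilon2)
    fix e :: real assume "e > 0"
    then have "a + e \<in> B" using assms a by auto
    then show "Inf (ereal ` B) \<le> x + ereal e" using a by (intro Inf_lower) auto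
  qed
qed

lemma dlog_order_mono:
  assumes "growth_le f g"
  shows "dlog_order f \<le> dlog_order g"
  unfolding dlog_order_def
proof (rule Inf_ereal_image_mono)
  fix a b :: real
  assume a: "a \<in> {a. a > 0 \<and> (\<forall>\<^sub>F r in at_top. max_mod g r \<le> r powr (ln (ln r) powr a))}" "a < b"
  then show "b \<in> {a. a > 0 \<and> (\<forall>\<^sub>F r in at_top. max_mod f r \<le> r powr (ln (ln r) powr a))}"
    using growth_le_eventually[OF assms, of a 1 1 b] by auto
qed

text \<open>Each type is measured against the function's own order, so the two orders must agree
  first. Their being positive and finite makes the real exponent positive, as the absorption of
  polynomial factors requires.\<close>

lemma dlog_type_mono:
  assumes "growth_le f g" "dlog_order f = dlog_order g" "0 < dlog_order g" "dlog_order g < \<infinity>"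
  shows "dlog_type f \<le> dlog_type g"
  unfolding dlog_type_def assms(2)
proof (rule Inf_ereal_image_mono)
  let ?\<rho> = "real_of_ereal (dlog_order g)"
  have "?\<rho> > 0" using assms by (cases "dlog_order g") auto
  fix a b :: real
  assume a: "a \<in> {c. c > 0 \<and> (\<forall>\<^sub>F r in at_top. max_mod g r \<le> r powr (c * ln (ln r) powr ?\<rho>))}" "a < b"
  then show "b \<in> {c. c > 0 \<and> (\<forall>\<^sub>F r in at_top. max_mod f r \<le> r powr (c * ln (ln r) powr ?\<rho>))}"
    using growth_le_eventually[OF assms(1) \<open>?\<rho> > 0\<close>, of a b] by auto
qed

section \<open>Maximum modulus and removal of the factor \<open>\<bar>Im z\<bar>\<close>\<close>

lemma max_mod_le:
  assumes "r \<ge> 0" "\<And>z. norm z \<le> r \<Longrightarrow> norm (f z) \<le> B"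
  shows "max_mod f r \<le> B"
  unfolding max_mod_def using assms by (intro cSUP_least) auto

text \<open>A real supremum is an upper bound only for a bounded set, hence the hypothesis with
  \<open>B\<close>.\<close>

lemma norm_le_max_mod:
  assumes "\<And>z. norm z \<le> r \<Longrightarrow> norm (f z) \<le> B" "norm z \<le> r"
  shows "norm (f z) \<le> max_mod f r"
  unfolding max_mod_def using assms
  by (intro cSUP_upper bdd_aboveI2[where M = B]) auto

text \<open>On the circle \<open>R^2 = z * cnj z\<close>, so the difference factors as
  \<open>z * (z - cnj z)\<close>.\<close>

lemma norm_square_minus_square:
  assumes "norm z = R"
  shows "norm (z\<^sup>2 - (complex_of_real R)\<^sup>2) = 2 * R * \<bar>Im z\<bar>"
proof -
  have "z\<^sup>2 - (complex_of_real R)\<^sup>2 = z * z - z * cnj z"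
    using assms complex_norm_square[of z] by (simp add: power2_eq_square)
  also have "\<dots> = z * (z - cnj z)" by (simp add: algebra_simps)
  finally show ?thesis using assms by (simp add: norm_mult complex_diff_cnj)
qed

text \<open>Multiplying by \<open>z\<^sup>2 - R\<^sup>2\<close> compensates a blow-up of the bound at the real axis.\<close>

lemma norm_le_of_Im_bound_on_circle:
  assumes hol: "f holomorphic_on UNIV" and "R > 0" and "norm z \<le> R / 2"
    and circle: "\<And>z. norm z = R \<Longrightarrow> \<bar>Im z\<bar> * norm (f z) \<le> M"
  shows "norm (f z) \<le> 8 * M / (3 * R)"
proof -
  define h where "h z = f z * (z\<^sup>2 - (complex_of_real R)\<^sup>2)" for z
  have h_hol: "h holomorphic_on UNIV" unfolding h_def by (intro holomorphic_intros hol)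
  have "norm (h z) \<le> 2 * R * M"
  proof (rule maximum_modulus_frontier[of h "ball 0 R"])
    show "h holomorphic_on interior (ball 0 R)" using h_hol holomorphic_on_subset by blast
    show "continuous_on (closure (ball 0 R)) h"
      using h_hol holomorphic_on_imp_continuous_on continuous_on_subset by blast
    show "z \<in> ball 0 R" using assms by auto
    fix w assume "w \<in> frontier (ball (0::complex) R)"
    then have w: "norm w = R" using \<open>R > 0\<close> by (simp add: frontier_ball)
    have "norm (h w) = 2 * R * (\<bar>Im w\<bar> * norm (f w))"
      unfolding h_def norm_mult norm_square_minus_square[OF w] by simp
    also have "\<dots> \<le> 2 * R * M" using circle[OF w] \<open>R > 0\<close> by (intro mult_left_mono) auto
    finally show "norm (h w) \<le> 2 * R * M" .
  qed simp
  \<comment> \<open>In the half disc radius the multiplier is at least \<open>R^2 - R^2 / 4\<close>.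
    Dividing \<open>2 * R * M\<close> by this gives the constant 8/3.\<close>
  moreover have "3 * R\<^sup>2 / 4 \<le> norm (z\<^sup>2 - (complex_of_real R)\<^sup>2)"
  proof -
    have "(norm z)\<^sup>2 \<le> (R / 2)\<^sup>2" using assms by (intro power_mono) auto
    moreover have "R\<^sup>2 - (norm z)\<^sup>2 \<le> norm ((complex_of_real R)\<^sup>2 - z\<^sup>2)"
      using norm_triangle_ineq2[of "(complex_of_real R)\<^sup>2" "z\<^sup>2"] by (simp add: norm_power)
    ultimately show ?thesis by (simp add: norm_minus_commute power_divide)
  qed
  ultimately have "norm (f z) * (3 * R\<^sup>2 / 4) \<le> 2 * R * M"
    unfolding h_def norm_mult by (meson mult_left_mono norm_ge_zero order_trans)
  then show ?thesis using \<open>R > 0\<close> by (simp add: field_simps power2_eq_square)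
qed

section \<open>Families of entire functions with locally bounded square sums\<close>

locale l2_family =
  fixes u :: "nat \<Rightarrow> complex \<Rightarrow> complex"
  assumes holomorphic: "u n holomorphic_on UNIV"
    and partial_sums_bounded: "\<exists>B. \<forall>z N. norm z \<le> r \<longrightarrow> (\<Sum>n<N. (norm (u n z))\<^sup>2) \<le> B"
begin

definition l2 :: "complex \<Rightarrow> real" where
  "l2 z = sqrt (\<Sum>n. (norm (u n z))\<^sup>2)"

lemma summable_square: "summable (\<lambda>n. (norm (u n z))\<^sup>2)"
proof -
  obtain B where "\<forall>w N. norm w \<le> norm z \<longrightarrow> (\<Sum>n<N. (norm (u n w))\<^sup>2) \<le> B"
    using partial_sums_bounded by blast
  then show ?thesis by (intro bounded_imp_summable[where B = B])
      (auto simp: lessThan_Suc_atMost[symmetric] simp del: sum.lessThan_Suc)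
qed

lemma l2_nonneg [simp]: "l2 z \<ge> 0"
  unfolding l2_def by (simp add: suminf_nonneg summable_square)

lemma l2_square: "(l2 z)\<^sup>2 = (\<Sum>n. (norm (u n z))\<^sup>2)"
  unfolding l2_def by (simp add: suminf_nonneg summable_square)

lemma L2_set_le_l2: "L2_set (\<lambda>n. norm (u n z)) {..<N} \<le> l2 z"
  unfolding l2_def L2_set_def
  by (intro real_sqrt_le_mono sum_le_suminf summable_square) auto

text \<open>Reduces estimates of \<open>l2\<close> to finite truncations, where Minkowski and
  Cauchy-Schwarz are available for \<open>L2_set\<close>.\<close>

lemma l2_le:
  assumes "\<And>N. L2_set (\<lambda>n. norm (u n z)) {..<N} \<le> B"
  shows "l2 z \<le> B"
proof -
  have "B \<ge> 0" using assms[of 0] by simp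
  have "(\<Sum>n<N. (norm (u n z))\<^sup>2) \<le> B\<^sup>2" for N
    using assms[of N] unfolding L2_set_def by (simp add: real_sqrt_le_iff' \<open>B \<ge> 0\<close> sqrt_le_D)
  then have "(\<Sum>n. (norm (u n z))\<^sup>2) \<le> B\<^sup>2"
    by (intro suminf_le_const summable_square)
  then show ?thesis unfolding l2_def using \<open>B \<ge> 0\<close> by (simp add: real_le_lsqrt suminf_nonneg summable_square)
qed

lemma norm_le_l2: "norm (u n z) \<le> l2 z"
proof -
  have "norm (u n z) \<le> L2_set (\<lambda>n. norm (u n z)) {..<Suc n}"
    by (rule member_le_L2_set) auto
  then show ?thesis using L2_set_le_l2 order_trans by blast
qed

lemma l2_bounded: "\<exists>B. \<forall>z. norm z \<le> r \<longrightarrow> l2 z \<le> B"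
proof -
  obtain B where B: "\<And>z N. norm z \<le> r \<Longrightarrow> (\<Sum>n<N. (norm (u n z))\<^sup>2) \<le> B"
    using partial_sums_bounded by blast
  have "l2 z \<le> sqrt B" if "norm z \<le> r" for z
    by (rule l2_le) (simp add: L2_set_def B that)
  then show ?thesis by blast
qed

lemma l2_le_max_mod:
  assumes "norm z \<le> r"
  shows "l2 z \<le> max_mod (\<lambda>z. of_real (l2 z)) r"
proof -
  obtain B where "\<And>z. norm z \<le> r \<Longrightarrow> l2 z \<le> B" using l2_bounded by blast
  then show ?thesis
    using norm_le_max_mod[of r "\<lambda>z. of_real (l2 z)" B z] assms by simp
qed

text \<open>The bound transfers from scalar functions by testing the vector \<open>(u\<^sub>0 z, u\<^sub>1 z, \<dots>)\<close>
  against its own value at the given point.\<close>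

lemma l2_le_of_Im_bound_on_circle:
  assumes "R > 0" "norm z \<le> R / 2" and circle: "\<And>z. norm z = R \<Longrightarrow> \<bar>Im z\<bar> * l2 z \<le> M"
  shows "l2 z \<le> 8 * M / (3 * R)"
proof (rule l2_le)
  fix N
  define s where "s = L2_set (\<lambda>n. norm (u n z)) {..<N}"
  define f where "f w = (\<Sum>n<N. cnj (u n z) * u n w)" for w
  have s0: "s \<ge> 0" unfolding s_def by simp
  have f_le: "norm (f w) \<le> s * l2 w" for w
  proof -
    have "norm (f w) \<le> (\<Sum>n<N. \<bar>norm (u n z)\<bar> * \<bar>norm (u n w)\<bar>)"
      unfolding f_def by (rule order_trans[OF norm_sum]) (simp add: norm_mult)
    also have "\<dots> \<le> s * L2_set (\<lambda>n. norm (u n w)) {..<N}"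
      unfolding s_def by (rule L2_set_mult_ineq)
    also have "\<dots> \<le> s * l2 w" by (intro mult_left_mono L2_set_le_l2 s0)
    finally show ?thesis .
  qed
  have "f z = of_real (s\<^sup>2)"
    unfolding f_def s_def L2_set_def
    by (simp add: sum_nonneg complex_norm_square mult.commute del: of_real_power)
  then have "s\<^sup>2 = norm (f z)" using s0 by (simp add: norm_power)
  also have "\<dots> \<le> 8 * (s * M) / (3 * R)"
  proof (rule norm_le_of_Im_bound_on_circle[where f = f and z = z])
    show "f holomorphic_on UNIV" unfolding f_def
      by (intro holomorphic_intros holomorphic)
    fix w :: complex assume w: "norm w = R"
    have "\<bar>Im w\<bar> * norm (f w) \<le> \<bar>Im w\<bar> * (s * l2 w)" by (intro mult_left_mono f_le) auto
    also have "\<dots> = s * (\<bar>Im w\<bar> * l2 w)" by simp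
    also have "\<dots> \<le> s * M" using circle[OF w] s0 by (intro mult_left_mono)
    finally show "\<bar>Im w\<bar> * norm (f w) \<le> s * M" .
  qed (use assms in auto)
  finally have *: "s * s \<le> s * (8 * M / (3 * R))" by (simp add: power2_eq_square)
  \<comment> \<open>At the real point \<open>R\<close> the factor \<open>\<bar>Im z\<bar>\<close>
    vanishes, so the hypothesis itself gives \<open>0 \<le> M\<close>. This settles the case
    \<open>s = 0\<close>, where \<open>s\<close> cannot be cancelled.\<close>
  have "0 \<le> M" using circle[of "of_real R"] \<open>R > 0\<close> by simp
  then show "L2_set (\<lambda>n. norm (u n z)) {..<N} \<le> 8 * M / (3 * R)"
    using mult_le_cancel_left_pos[of s s "8 * M / (3 * R)"] * s0 \<open>R > 0\<close>
    unfolding s_def[symmetric] by (cases "s = 0") simp_all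
qed

text \<open>The hypothesis is used on the circle of radius \<open>2 * r\<close>; the preceding lemma
  then bounds \<open>l2\<close> on the disc of radius \<open>r\<close> without the factor
  \<open>\<bar>Im z\<bar>\<close>.\<close>

lemma l2_growth_le:
  assumes "C > 0" and bound: "\<And>z. norm z \<ge> 1 \<Longrightarrow> \<bar>Im z\<bar> * l2 z \<le> C * norm z ^ m * max_mod g (norm z)"
  shows "growth_le (\<lambda>z. of_real (l2 z)) g"
proof (rule growth_leI)
  show "4 * C * 2 ^ m > 0" "(2::real) \<ge> 1" using \<open>C > 0\<close> by auto
  fix r :: real assume r: "r \<ge> 1"
  define M where "M = C * (2 * r) ^ m * max_mod g (2 * r)"
  have "0 \<le> M" using bound[of "of_real (2 * r)"] r by (simp add: M_def)
  show "max_mod (\<lambda>z. of_real (l2 z)) r \<le> 4 * C * 2 ^ m * r ^ m * max_mod g (2 * r)"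
  proof (rule max_mod_le)
    fix z :: complex assume z: "norm z \<le> r"
    have "l2 z \<le> 8 * M / (3 * (2 * r))"
    proof (rule l2_le_of_Im_bound_on_circle)
      fix w :: complex assume "norm w = 2 * r"
      then show "\<bar>Im w\<bar> * l2 w \<le> M" using bound[of w] r by (simp add: M_def)
    qed (use r z in auto)
    also have "\<dots> \<le> 8 * M / 6" using r \<open>0 \<le> M\<close> by (intro divide_left_mono) auto
    also have "\<dots> \<le> 4 * M" using \<open>0 \<le> M\<close> by simp
    also have "\<dots> = 4 * C * 2 ^ m * r ^ m * max_mod g (2 * r)" by (simp add: M_def power_mult_distrib)
    finally show "norm (complex_of_real (l2 z)) \<le> 4 * C * 2 ^ m * r ^ m * max_mod g (2 * r)" by simp
  qed (use r in auto)
qed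

text \<open>Cauchy-Schwarz on partial sums gives absolute convergence together with the
  bound.\<close>

lemma
  assumes a: "summable (\<lambda>k. (norm (a k))\<^sup>2)"
  shows summable_mult_series: "summable (\<lambda>k. a k * u k z)"
    and norm_mult_series_le: "norm (\<Sum>k. a k * u k z) \<le> sqrt (\<Sum>k. (norm (a k))\<^sup>2) * l2 z"
proof -
  let ?a = "sqrt (\<Sum>k. (norm (a k))\<^sup>2)"
  have part: "(\<Sum>k<N. norm (a k * u k z)) \<le> ?a * l2 z" for N
  proof -
    have "(\<Sum>k<N. norm (a k * u k z)) = (\<Sum>k<N. \<bar>norm (a k)\<bar> * \<bar>norm (u k z)\<bar>)"
      by (simp add: norm_mult)
    also have "\<dots> \<le> L2_set (\<lambda>k. norm (a k)) {..<N} * L2_set (\<lambda>k. norm (u k z)) {..<N}"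
      by (rule L2_set_mult_ineq)
    also have "\<dots> \<le> ?a * l2 z"
      by (intro mult_mono L2_set_le_l2)
        (auto simp: L2_set_def suminf_nonneg sum_nonneg a intro!: sum_le_suminf[OF a])
    finally show ?thesis .
  qed
  then have abs: "summable (\<lambda>k. norm (a k * u k z))"
    by (intro bounded_imp_summable[where B = "?a * l2 z"])
      (auto simp: lessThan_Suc_atMost[symmetric] simp del: sum.lessThan_Suc)
  then show "summable (\<lambda>k. a k * u k z)" by (rule summable_norm_cancel)
  have "norm (\<Sum>k. a k * u k z) \<le> (\<Sum>k. norm (a k * u k z))" by (rule summable_norm[OF abs])
  also have "\<dots> \<le> ?a * l2 z" by (rule suminf_le_const[OF abs part])
  finally show "norm (\<Sum>k. a k * u k z) \<le> ?a * l2 z" .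
qed

end

section \<open>The Christoffel-Darboux identity\<close>

text \<open>Covers both \<open>u = P\<close>, with \<open>F = B\<close>, \<open>G = D\<close>, and \<open>u = Q\<close>, with \<open>F = A\<close>, \<open>G = C\<close>;
  in either case \<open>\<alpha>\<^sub>n = P\<^sub>n(0)\<close> and \<open>\<beta>\<^sub>n = Q\<^sub>n(0)\<close>.\<close>

locale christoffel_darboux_family = l2_family +
  fixes \<alpha> \<beta> :: "nat \<Rightarrow> complex" and e d :: complex
  assumes cnj_u: "u n (cnj z) = cnj (u n z)"
    and recurrence: "u n z = \<beta> n * (d + z * (\<Sum>k<n. \<alpha> k * u k z)) - \<alpha> n * (e + z * (\<Sum>k<n. \<beta> k * u k z))"
    and summable_\<alpha>: "summable (\<lambda>n. (norm (\<alpha> n))\<^sup>2)"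
    and summable_\<beta>: "summable (\<lambda>n. (norm (\<beta> n))\<^sup>2)"
    and l2_bounded_below: "\<exists>q>0. \<forall>z. l2 z \<ge> q"
begin

definition F :: "complex \<Rightarrow> complex" where "F z = e + z * (\<Sum>k. \<beta> k * u k z)"
definition G :: "complex \<Rightarrow> complex" where "G z = d + z * (\<Sum>k. \<alpha> k * u k z)"

text \<open>Passing from \<open>n\<close> to \<open>Suc n\<close> adds multiples of
  \<open>u n\<close> to both functions. The products of two added terms cancel, and the recurrence
  turns the remaining brackets into \<open>u n w\<close> and \<open>u n z\<close>. For
  \<open>n = 0\<close> both functions are constant and the right side vanishes.\<close>

lemma christoffel_darboux_partial:
  fixes z w :: complex
  defines "Fn \<equiv> \<lambda>n z. e + z * (\<Sum>k<n. \<beta> k * u k z)" and "Gn \<equiv> \<lambda>n z. d + z * (\<Sum>k<n. \<alpha> k * u k z)"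
  shows "(z - w) * (\<Sum>k<n. u k z * u k w) = Fn n z * Gn n w - Gn n z * Fn n w"
proof (induction n)
  case 0
  then show ?case by (simp add: Fn_def Gn_def)
next
  case (Suc n)
  have F: "Fn (Suc n) x = Fn n x + x * \<beta> n * u n x" for x by (simp add: Fn_def algebra_simps)
  have G: "Gn (Suc n) x = Gn n x + x * \<alpha> n * u n x" for x by (simp add: Gn_def algebra_simps)
  have r: "u n x = \<beta> n * Gn n x - \<alpha> n * Fn n x" for x
    unfolding Fn_def Gn_def by (rule recurrence)
  have "Fn (Suc n) z * Gn (Suc n) w - Gn (Suc n) z * Fn (Suc n) w =
      (Fn n z * Gn n w - Gn n z * Fn n w)
      + z * u n z * (\<beta> n * Gn n w - \<alpha> n * Fn n w) - w * u n w * (\<beta> n * Gn n z - \<alpha> n * Fn n z)"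
    unfolding F G by (simp add: algebra_simps)
  also have "\<dots> = (z - w) * (\<Sum>k<n. u k z * u k w) + z * u n z * u n w - w * u n w * u n z"
    unfolding Suc r[symmetric] ..
  also have "\<dots> = (z - w) * (\<Sum>k<Suc n. u k z * u k w)" by (simp add: algebra_simps)
  finally show ?case ..
qed

text \<open>Limit of the finite identity at \<open>w = cnj z\<close>, where
  \<open>u k z * u k w\<close> is the squared modulus of \<open>u k z\<close>.\<close>

lemma christoffel_darboux:
  "(z - cnj z) * of_real ((l2 z)\<^sup>2) = F z * G (cnj z) - G z * F (cnj z)"
proof (rule LIMSEQ_unique)
  have "(\<lambda>n. \<Sum>k<n. (norm (u k z))\<^sup>2) \<longlonglongrightarrow> (l2 z)\<^sup>2"
    unfolding l2_square by (rule summable_LIMSEQ[OF summable_square])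
  then have "(\<lambda>n. of_real (\<Sum>k<n. (norm (u k z))\<^sup>2)) \<longlonglongrightarrow> complex_of_real ((l2 z)\<^sup>2)"
    by (rule tendsto_of_real)
  moreover have "complex_of_real (\<Sum>k<n. (norm (u k z))\<^sup>2) = (\<Sum>k<n. u k z * u k (cnj z))" for n
    unfolding cnj_u of_real_sum by (simp only: complex_norm_square)
  ultimately have "(\<lambda>n. \<Sum>k<n. u k z * u k (cnj z)) \<longlonglongrightarrow> of_real ((l2 z)\<^sup>2)" by simp
  then show "(\<lambda>n. (z - cnj z) * (\<Sum>k<n. u k z * u k (cnj z))) \<longlonglongrightarrow> (z - cnj z) * of_real ((l2 z)\<^sup>2)"
    by (intro tendsto_intros)
  show "(\<lambda>n. (z - cnj z) * (\<Sum>k<n. u k z * u k (cnj z))) \<longlonglongrightarrow> F z * G (cnj z) - G z * F (cnj z)"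
    unfolding christoffel_darboux_partial F_def G_def
    by (intro tendsto_intros summable_LIMSEQ summable_mult_series summable_\<alpha> summable_\<beta>)
qed

lemma Im_l2_le:
  "2 * \<bar>Im z\<bar> * (l2 z)\<^sup>2 \<le> norm (F z) * norm (G (cnj z)) + norm (G z) * norm (F (cnj z))"
proof -
  have "2 * \<bar>Im z\<bar> * (l2 z)\<^sup>2 = norm ((z - cnj z) * of_real ((l2 z)\<^sup>2))"
    unfolding complex_diff_cnj norm_mult norm_of_real by (simp add: abs_mult)
  also have "\<dots> \<le> norm (F z) * norm (G (cnj z)) + norm (G z) * norm (F (cnj z))"
    unfolding christoffel_darboux by (metis norm_mult norm_triangle_ineq4)
  finally show ?thesis .
qed

lemma l2_cnj: "l2 (cnj z) = l2 z"
  unfolding l2_def cnj_u by simp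

text \<open>Cauchy-Schwarz controls the series; the positive lower bound \<open>q\<close> of
  \<open>l2\<close> lets the constant \<open>c\<close> be absorbed too.\<close>

lemma series_le_l2:
  assumes "summable (\<lambda>k. (norm (a k))\<^sup>2)"
  obtains C where "C > 0"
    "\<And>r z. r \<ge> 1 \<Longrightarrow> norm z \<le> r \<Longrightarrow> norm (c + z * (\<Sum>k. a k * u k z)) \<le> C * r * l2 z"
proof -
  obtain q where q: "q > 0" "\<And>z. l2 z \<ge> q" using l2_bounded_below by blast
  define b where "b = sqrt (\<Sum>k. (norm (a k))\<^sup>2)"
  have b: "b \<ge> 0" unfolding b_def by (simp add: suminf_nonneg assms)
  show thesis
  proof
    show "1 + norm c / q + b > 0" using q b by (simp add: add_pos_nonneg)
    fix r :: real and z :: complex assume r: "r \<ge> 1" and z: "norm z \<le> r"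
    have "norm (c + z * (\<Sum>k. a k * u k z)) \<le> norm c + norm z * norm (\<Sum>k. a k * u k z)"
      by (rule order_trans[OF norm_triangle_ineq]) (simp add: norm_mult)
    also have "\<dots> \<le> norm c / q * (r * l2 z) + r * (b * l2 z)"
    proof (rule add_mono)
      have "q \<le> r * l2 z" using mult_mono[of 1 r q "l2 z"] q r by auto
      then show "norm c \<le> norm c / q * (r * l2 z)"
        using mult_left_mono[of q "r * l2 z" "norm c / q"] q by simp
      show "norm z * norm (\<Sum>k. a k * u k z) \<le> r * (b * l2 z)"
        unfolding b_def by (intro mult_mono z norm_mult_series_le assms) (use r in auto)
    qed
    also have "\<dots> \<le> (1 + norm c / q + b) * r * l2 z"
      using r by (simp add: algebra_simps)
    finally show "norm (c + z * (\<Sum>k. a k * u k z)) \<le> (1 + norm c / q + b) * r * l2 z" .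
  qed
qed

lemma series_growth_le:
  assumes "summable (\<lambda>k. (norm (a k))\<^sup>2)"
  shows "growth_le (\<lambda>z. c + z * (\<Sum>k. a k * u k z)) (\<lambda>z. of_real (l2 z))"
proof -
  obtain C where C: "C > 0"
    "\<And>r z. r \<ge> 1 \<Longrightarrow> norm z \<le> r \<Longrightarrow> norm (c + z * (\<Sum>k. a k * u k z)) \<le> C * r * l2 z"
    using series_le_l2[OF assms] by blast
  show ?thesis
  proof (rule growth_leI[where C = C and m = 1 and K = 1])
    fix r :: real assume r: "r \<ge> 1"
    show "max_mod (\<lambda>z. c + z * (\<Sum>k. a k * u k z)) r \<le> C * r ^ 1 * max_mod (\<lambda>z. of_real (l2 z)) (1 * r)"
    proof (rule max_mod_le)
      fix z :: complex assume z: "norm z \<le> r"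
      have "norm (c + z * (\<Sum>k. a k * u k z)) \<le> C * r * l2 z" by (rule C(2)[OF r z])
      also have "\<dots> \<le> C * r * max_mod (\<lambda>z. of_real (l2 z)) r"
        using C r z by (intro mult_left_mono l2_le_max_mod) auto
      finally show "norm (c + z * (\<Sum>k. a k * u k z)) \<le> C * r ^ 1 * max_mod (\<lambda>z. of_real (l2 z)) (1 * r)"
        by simp
    qed (use r in auto)
  qed (use C in auto)
qed

text \<open>Every product in \<open>Im\<close> contains exactly one value of \<open>g\<close>, which
  is at most a multiple of \<open>norm z * l2 z\<close>, because \<open>l2\<close> is invariant
  under conjugation. One factor \<open>l2 z\<close> cancels, leaving a bound by the maximum modulus
  of \<open>f\<close>. Abstract \<open>f\<close> and \<open>g\<close> allow the roles of
  \<open>F\<close> and \<open>G\<close> to be exchanged.\<close>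

lemma l2_growth_le_series:
  assumes a: "summable (\<lambda>k. (norm (a k))\<^sup>2)" and b: "summable (\<lambda>k. (norm (b k))\<^sup>2)"
    and f_def: "\<And>z. f z = c + z * (\<Sum>k. a k * u k z)" and g_def: "\<And>z. g z = c' + z * (\<Sum>k. b k * u k z)"
    and Im: "\<And>z. 2 * \<bar>Im z\<bar> * (l2 z)\<^sup>2 \<le> norm (f z) * norm (g (cnj z)) + norm (g z) * norm (f (cnj z))"
  shows "growth_le (\<lambda>z. of_real (l2 z)) f"
proof -
  obtain C where C: "C > 0" "\<And>r z. r \<ge> 1 \<Longrightarrow> norm z \<le> r \<Longrightarrow> norm (f z) \<le> C * r * l2 z"
    using series_le_l2[OF a] unfolding f_def by metis
  obtain C' where C': "C' > 0" "\<And>r z. r \<ge> 1 \<Longrightarrow> norm z \<le> r \<Longrightarrow> norm (g z) \<le> C' * r * l2 z"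
    using series_le_l2[OF b] unfolding g_def by metis
  obtain q where q: "q > 0" "\<And>z. l2 z \<ge> q" using l2_bounded_below by blast
  show ?thesis
  proof (rule l2_growth_le[OF C'(1), where m = 1])
    fix z :: complex assume z: "norm z \<ge> 1"
    obtain B where B: "\<And>w. norm w \<le> norm z \<Longrightarrow> l2 w \<le> B" using l2_bounded by blast
    have "norm (f w) \<le> C * norm z * B" if "norm w \<le> norm z" for w
    proof -
      have "C * norm z * l2 w \<le> C * norm z * B" using B[OF that] C(1) by (intro mult_left_mono) auto
      then show ?thesis using C(2)[OF z that] by linarith
    qed
    then have f: "norm (f w) \<le> max_mod f (norm z)" if "norm w \<le> norm z" for w
      using that by (rule norm_le_max_mod)
    have g: "norm (g z) \<le> C' * norm z * l2 z" "norm (g (cnj z)) \<le> C' * norm z * l2 z"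
      using C'(2)[OF z, of z] C'(2)[OF z, of "cnj z"] by (auto simp: l2_cnj)
    have "2 * \<bar>Im z\<bar> * (l2 z)\<^sup>2 \<le> norm (f z) * norm (g (cnj z)) + norm (g z) * norm (f (cnj z))"
      by (rule Im)
    also have "\<dots> \<le> max_mod f (norm z) * (C' * norm z * l2 z) + (C' * norm z * l2 z) * max_mod f (norm z)"
      using order_trans[OF norm_ge_zero f[of z]] C'(1)
      by (intro add_mono mult_mono g f) simp_all
    also have "\<dots> = 2 * l2 z * (C' * norm z ^ 1 * max_mod f (norm z))" by simp
    finally have "(2 * l2 z) * (\<bar>Im z\<bar> * l2 z) \<le> (2 * l2 z) * (C' * norm z ^ 1 * max_mod f (norm z))"
      by (simp add: power2_eq_square mult_ac)
    moreover have "l2 z > 0" using q less_le_trans by blast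
    ultimately show "\<bar>Im z\<bar> * l2 z \<le> C' * norm z ^ 1 * max_mod f (norm z)"
      using mult_le_cancel_left_pos[of "2 * l2 z"] by simp
  qed
qed

lemma F_growth_le: "growth_le F (\<lambda>z. of_real (l2 z))"
  unfolding F_def by (rule series_growth_le[OF summable_\<beta>])

lemma G_growth_le: "growth_le G (\<lambda>z. of_real (l2 z))"
  unfolding G_def by (rule series_growth_le[OF summable_\<alpha>])

lemma l2_growth_le_F: "growth_le (\<lambda>z. of_real (l2 z)) F"
  by (rule l2_growth_le_series[OF summable_\<beta> summable_\<alpha> F_def G_def Im_l2_le])

lemma l2_growth_le_G: "growth_le (\<lambda>z. of_real (l2 z)) G"
  by (rule l2_growth_le_series[OF summable_\<alpha> summable_\<beta> G_def F_def])
     (subst add.commute, rule Im_l2_le)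

end

section \<open>Injectivity of the Cauchy transform\<close>

text \<open>The right side is \<pi> times the Poisson kernel of the upper half-plane.\<close>

lemma Im_cauchy_kernel:
  "Im (1 / (of_real x - Complex t y)) = y / ((x - t)\<^sup>2 + y\<^sup>2)"
  by (simp add: Im_divide power2_eq_square)

lemma norm_cauchy_kernel_le:
  assumes "Im z \<noteq> 0"
  shows "norm (1 / (of_real x - z)) \<le> 1 / \<bar>Im z\<bar>"
proof -
  have "\<bar>Im z\<bar> \<le> norm (of_real x - z)" using abs_Im_le_cmod[of "of_real x - z"] by simp
  then show ?thesis using assms by (simp add: norm_divide frac_le)
qed

context real_distribution
begin

lemma integrable_cauchy_kernel:
  assumes "Im z \<noteq> 0"
  shows "integrable M (\<lambda>x. 1 / (of_real x - z))"
  by (rule integrable_const_bound[where B = "1 / \<bar>Im z\<bar>"])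
     (use assms norm_cauchy_kernel_le in auto)

lemma integral_poisson_kernel:
  assumes "y > 0"
  shows "integrable M (\<lambda>x. y / ((x - t)\<^sup>2 + y\<^sup>2))"
    and "(\<integral>x. y / ((x - t)\<^sup>2 + y\<^sup>2) \<partial>M) = Im (\<integral>x. 1 / (of_real x - Complex t y) \<partial>M)"
proof -
  have i: "integrable M (\<lambda>x. 1 / (of_real x - Complex t y))"
    using assms by (intro integrable_cauchy_kernel) simp
  show "integrable M (\<lambda>x. y / ((x - t)\<^sup>2 + y\<^sup>2))"
    using integrable_Im[OF i] by (simp only: Im_cauchy_kernel)
  show "(\<integral>x. y / ((x - t)\<^sup>2 + y\<^sup>2) \<partial>M) = Im (\<integral>x. 1 / (of_real x - Complex t y) \<partial>M)"
    using integral_Im[OF i] by (simp only: Im_cauchy_kernel)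
qed

text \<open>Tonelli: for fixed \<open>x\<close> the Poisson kernel has the antiderivative
  \<open>arctan ((t - x) / y)\<close> in \<open>t\<close>. The left side is a smoothed version of
  \<pi> times the mass to the right of \<open>a\<close>, and the right side is determined by the
  Cauchy transform.\<close>

lemma integral_arctan_eq_poisson:
  assumes "y > 0"
  shows "ennreal (\<integral>x. pi / 2 - arctan ((a - x) / y) \<partial>M) =
    (\<integral>\<^sup>+t. ennreal (\<integral>x. y / ((x - t)\<^sup>2 + y\<^sup>2) \<partial>M) * indicator {a..} t \<partial>lborel)"
proof -
  interpret L: pair_sigma_finite M lborel ..
  have arctan_le: "0 \<le> pi / 2 - arctan u" "pi / 2 - arctan u \<le> pi" for u
    using arctan_bounded[of u] by auto
  have int: "integrable M (\<lambda>x. pi / 2 - arctan ((a - x) / y))"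
    by (rule integrable_const_bound[where B = pi]) (use arctan_le in auto)
  have inner: "(\<integral>\<^sup>+t. ennreal (y / ((x - t)\<^sup>2 + y\<^sup>2)) * indicator {a..} t \<partial>lborel)
      = ennreal (pi / 2 - arctan ((a - x) / y))" for x
  proof (rule nn_integral_FTC_atLeast)
    fix t
    have "((\<lambda>t. arctan ((t - x) / y)) has_real_derivative inverse (1 + ((t - x) / y)\<^sup>2) * (1 / y)) (at t)"
      using assms by (auto intro!: derivative_eq_intros)
    moreover have "inverse (1 + ((t - x) / y)\<^sup>2) * (1 / y) = y / ((x - t)\<^sup>2 + y\<^sup>2)"
      using assms by (simp add: divide_simps power2_commute[of t x]) (simp add: power2_eq_square algebra_simps)
    ultimately show "((\<lambda>t. arctan ((t - x) / y)) has_real_derivative y / ((x - t)\<^sup>2 + y\<^sup>2)) (at t)" by simp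
  next
    show "((\<lambda>t. arctan ((t - x) / y)) \<longlongrightarrow> pi / 2) at_top" using assms by real_asymp
  qed (use assms in auto)
  have "ennreal (\<integral>x. pi / 2 - arctan ((a - x) / y) \<partial>M)
      = (\<integral>\<^sup>+x. ennreal (pi / 2 - arctan ((a - x) / y)) \<partial>M)"
    using nn_integral_eq_integral[OF int] arctan_le by simp
  also have "\<dots> = (\<integral>\<^sup>+x. (\<integral>\<^sup>+t. ennreal (y / ((x - t)\<^sup>2 + y\<^sup>2)) * indicator {a..} t \<partial>lborel) \<partial>M)"
    unfolding inner ..
  also have "\<dots> = (\<integral>\<^sup>+t. (\<integral>\<^sup>+x. ennreal (y / ((x - t)\<^sup>2 + y\<^sup>2)) * indicator {a..} t \<partial>M) \<partial>lborel)"
    by (rule L.Fubini'[symmetric]) (simp add: split_beta')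
  also have "\<dots> = (\<integral>\<^sup>+t. ennreal (\<integral>x. y / ((x - t)\<^sup>2 + y\<^sup>2) \<partial>M) * indicator {a..} t \<partial>lborel)"
  proof (rule nn_integral_cong)
    fix t
    have "(\<integral>\<^sup>+x. ennreal (y / ((x - t)\<^sup>2 + y\<^sup>2)) \<partial>M) = ennreal (\<integral>x. y / ((x - t)\<^sup>2 + y\<^sup>2) \<partial>M)"
      by (rule nn_integral_eq_integral) (use assms integral_poisson_kernel in auto)
    then show "(\<integral>\<^sup>+x. ennreal (y / ((x - t)\<^sup>2 + y\<^sup>2)) * indicator {a..} t \<partial>M)
      = ennreal (\<integral>x. y / ((x - t)\<^sup>2 + y\<^sup>2) \<partial>M) * indicator {a..} t"
      by (subst nn_integral_multc) simp_all
  qed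
  finally show ?thesis .
qed

lemma integral_arctan_nonneg: "0 \<le> (\<integral>x. pi / 2 - arctan ((a - x) / y) \<partial>M)"
  using arctan_ubound by (intro integral_nonneg_AE) (auto intro: less_imp_le)

text \<open>Shrinking \<open>y\<close> faster than the shift \<open>sqrt y\<close> of \<open>a\<close> makes the limit \<open>0\<close> at an atom \<open>x = a\<close>.\<close>

lemma integral_arctan_tendsto:
  "(\<lambda>n. \<integral>x. pi / 2 - arctan ((a + 1 / real (Suc n) - x) / (1 / (real (Suc n))\<^sup>2)) \<partial>M)
     \<longlonglongrightarrow> pi * measure M {a<..}"
proof -
  have "(\<lambda>n. \<integral>x. pi / 2 - arctan ((a + 1 / real (Suc n) - x) / (1 / (real (Suc n))\<^sup>2)) \<partial>M)
     \<longlonglongrightarrow> (\<integral>x. pi * indicator {a<..} x \<partial>M)"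
  proof (rule integral_dominated_convergence[where w = "\<lambda>_. pi"])
    show "AE x in M. (\<lambda>n. pi / 2 - arctan ((a + 1 / real (Suc n) - x) / (1 / (real (Suc n))\<^sup>2)))
        \<longlonglongrightarrow> pi * indicator {a<..} x"
    proof (rule AE_I2)
      fix x
      define d where "d = a - x"
      have eq: "(a + 1 / real (Suc n) - x) / (1 / (real (Suc n))\<^sup>2)
          = d * (real (Suc n))\<^sup>2 + real (Suc n)" for n
        by (simp add: d_def field_simps power2_eq_square del: of_nat_Suc)
      have "(\<lambda>n. pi / 2 - arctan (d * (real (Suc n))\<^sup>2 + real (Suc n))) \<longlonglongrightarrow> pi * of_bool (d < 0)"
      proof (cases d "0 :: real" rule: linorder_cases)
        case less
        then have "(\<lambda>n. pi / 2 - arctan (d * (real (Suc n))\<^sup>2 + real (Suc n))) \<longlonglongrightarrow> pi / 2 - (-pi / 2)"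
          by real_asymp
        then show ?thesis using less by simp
      next
        case equal
        have "(\<lambda>n. pi / 2 - arctan (real (Suc n))) \<longlonglongrightarrow> 0" by real_asymp
        then show ?thesis using equal by simp
      next
        case greater
        then have "(\<lambda>n. pi / 2 - arctan (d * (real (Suc n))\<^sup>2 + real (Suc n))) \<longlonglongrightarrow> 0"
          by real_asymp
        then show ?thesis using greater by simp
      qed
      moreover have "of_bool (d < 0) = (indicator {a<..} x :: real)" by (simp add: d_def indicator_def)
      ultimately show "(\<lambda>n. pi / 2 - arctan ((a + 1 / real (Suc n) - x) / (1 / (real (Suc n))\<^sup>2)))
        \<longlonglongrightarrow> pi * indicator {a<..} x" unfolding eq by simp
    qed
    fix n
    have "norm (pi / 2 - arctan u) \<le> pi" for u
      using arctan_bounded[of u] by (auto simp: abs_le_iff)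
    then show "AE x in M. norm (pi / 2 - arctan ((a + 1 / real (Suc n) - x) / (1 / (real (Suc n))\<^sup>2))) \<le> pi"
      by blast
  qed auto
  then show ?thesis by simp
qed

end

text \<open>Stieltjes inversion: equal transforms have equal imaginary parts, that is, equal Poisson
  integrals. Hence the smoothed tails agree, their limits give the same mass on
  \<open>{a<..}\<close>, and the distribution functions coincide.\<close>

lemma cauchy_transform_unique:
  assumes M: "real_distribution M" and N: "real_distribution N"
    and eq: "\<And>z. Im z > 0 \<Longrightarrow>
      (\<integral>x. 1 / (complex_of_real x - z) \<partial>M) = (\<integral>x. 1 / (complex_of_real x - z) \<partial>N)"
  shows "M = N"
proof (rule cdf_unique[OF M N], rule ext)
  fix a :: real
  interpret M: real_distribution M by fact
  interpret N: real_distribution N by fact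
  have "(\<integral>x. y / ((x - t)\<^sup>2 + y\<^sup>2) \<partial>M) = (\<integral>x. y / ((x - t)\<^sup>2 + y\<^sup>2) \<partial>N)" if "y > 0" for y t
    using M.integral_poisson_kernel(2)[OF that] N.integral_poisson_kernel(2)[OF that]
      eq[of "Complex t y"] that by simp
  then have "ennreal (\<integral>x. pi / 2 - arctan ((b - x) / y) \<partial>M)
      = ennreal (\<integral>x. pi / 2 - arctan ((b - x) / y) \<partial>N)" if "y > 0" for y b
    using M.integral_arctan_eq_poisson[OF that] N.integral_arctan_eq_poisson[OF that] that by simp
  then have eqI: "(\<integral>x. pi / 2 - arctan ((b - x) / y) \<partial>M) = (\<integral>x. pi / 2 - arctan ((b - x) / y) \<partial>N)"
    if "y > 0" for y b
    using that M.integral_arctan_nonneg N.integral_arctan_nonneg by (simp add: ennreal_inj)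
  have pos: "1 / (real (Suc n))\<^sup>2 > 0" for n by simp
  have "(\<lambda>n. \<integral>x. pi / 2 - arctan ((a + 1 / real (Suc n) - x) / (1 / (real (Suc n))\<^sup>2)) \<partial>M)
     \<longlonglongrightarrow> pi * measure N {a<..}"
    unfolding eqI[OF pos] by (rule N.integral_arctan_tendsto)
  then have "pi * measure M {a<..} = pi * measure N {a<..}"
    using M.integral_arctan_tendsto[of a] LIMSEQ_unique by blast
  moreover have "measure R {..a} = 1 - measure R {a<..}" if "real_distribution R" for R
  proof -
    interpret real_distribution R by fact
    have "space R - {a<..} = {..a}" by auto
    then show ?thesis using prob_compl[of "{a<..}"] by simp
  qed
  ultimately show "cdf M a = cdf N a" using M N by (simp add: cdf_def)
qed

section \<open>Orthonormal polynomials\<close>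

lemma poly_map_poly_of_real:
  "poly (map_poly of_real q :: complex poly) (of_real x) = of_real (poly q x)"
  by (induction q) (auto simp: map_poly_pCons)

lemma poly_map_poly_of_real_cnj:
  "poly (map_poly of_real q :: complex poly) (cnj z) = cnj (poly (map_poly of_real q) z)"
  by (induction q) (auto simp: map_poly_pCons)

lemma poly_synthetic_div:
  fixes q :: "'a :: comm_ring_1 poly"
  shows "poly q z = poly q z0 + (z - z0) * poly (synthetic_div q z0) z"
  by (subst (1) synthetic_div_correct'[of z0 q, symmetric]) (simp add: algebra_simps)

text \<open>Both sides are the difference quotient of \<open>q\<close> at the points
  \<open>a\<close> and \<open>b\<close>, which is symmetric.\<close>

lemma poly_synthetic_div_commute:
  fixes q :: "'a :: comm_ring_1 poly"
  shows "poly (synthetic_div q a) b = poly (synthetic_div q b) a"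
proof (induction q)
  case (pCons c q)
  have "poly q b = poly q a + (b - a) * poly (synthetic_div q a) b"
    by (rule poly_synthetic_div)
  then show ?case using pCons.IH by (simp add: algebra_simps)
qed simp

lemma pCons_mult_cancel:
  fixes p q :: "'a :: idom poly"
  assumes "[:- c, 1:] * p = [:- c, 1:] * q"
  shows "p = q"
  using assms by (subst (asm) mult_left_cancel) auto

lemma linear_mult_synthetic_div:
  fixes q :: "'a :: comm_ring_1 poly"
  shows "[:- c, 1:] * synthetic_div q c = q - [:poly q c:]"
  using synthetic_div_correct'[of c q] by (simp add: algebra_simps)

lemma synthetic_div_add:
  fixes p q :: "'a :: idom poly"
  shows "synthetic_div (p + q) c = synthetic_div p c + synthetic_div q c"
  by (rule pCons_mult_cancel[of c])
     (simp only: distrib_left linear_mult_synthetic_div, simp add: algebra_simps)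

lemma synthetic_div_smult:
  fixes q :: "'a :: idom poly"
  shows "synthetic_div (smult a q) c = smult a (synthetic_div q c)"
  by (rule pCons_mult_cancel[of c])
     (simp only: mult_smult_right linear_mult_synthetic_div, simp add: smult_diff_right)

lemma synthetic_div_sum:
  fixes f :: "'b \<Rightarrow> 'a :: idom poly"
  shows "synthetic_div (\<Sum>i\<in>A. f i) c = (\<Sum>i\<in>A. synthetic_div (f i) c)"
  by (induction A rule: infinite_finite_induct) (simp_all add: synthetic_div_add)

text \<open>This is the relation between first and second divided differences. Multiplying by the
  linear factor at \<open>z\<close> reduces it to polynomial arithmetic.\<close>

lemma synthetic_div_change_point:
  fixes q :: "'a :: idom poly"
  shows "synthetic_div q z =
    synthetic_div q z0 + smult (z - z0) (synthetic_div (synthetic_div q z0) z)"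
proof (rule pCons_mult_cancel[of z])
  let ?s = "synthetic_div q z0"
  have "[:- z, 1:] * synthetic_div q z = q - [:poly q z0:] - smult (z - z0) [:poly ?s z:]"
    unfolding linear_mult_synthetic_div by (simp add: poly_synthetic_div[of q z z0])
  also have "\<dots> = [:- z0, 1:] * ?s - smult (z - z0) [:poly ?s z:]"
    by (simp only: linear_mult_synthetic_div)
  also have "[:- z0, 1:] * ?s = [:- z, 1:] * ?s + smult (z - z0) ?s"
    by (simp add: smult_diff_left algebra_simps)
  also have "\<dots> - smult (z - z0) [:poly ?s z:]
      = [:- z, 1:] * (?s + smult (z - z0) (synthetic_div ?s z))"
    by (simp only: distrib_left mult_smult_right linear_mult_synthetic_div smult_diff_right)
       (simp only: add_diff_eq)
  finally show "[:- z, 1:] * synthetic_div q z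
      = [:- z, 1:] * (?s + smult (z - z0) (synthetic_div ?s z))" .
qed

section \<open>The moment functional and orthonormal expansions\<close>

locale orthonormal_system = real_distribution M for M +
  fixes p :: "nat \<Rightarrow> real poly"
  assumes integrable_power: "integrable M (\<lambda>x. x ^ n)"
    and orthonormal: "orthonormal_polys M p"
begin

definition E :: "complex poly \<Rightarrow> complex" where
  "E q = (\<integral>x. poly q (of_real x) \<partial>M)"

abbreviation cp :: "nat \<Rightarrow> complex poly" where "cp n \<equiv> map_poly of_real (p n)"

lemma integrable_of_real_power: "integrable M (\<lambda>x. complex_of_real x ^ n)"
  using integrable_of_real[OF integrable_power[of n], where 'a = complex] by simp

lemma integrable_poly: "integrable M (\<lambda>x. poly (q :: complex poly) (of_real x))"
  unfolding poly_altdef by (auto intro!: integrable_of_real_power)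

text \<open>Shows that \<open>E\<close> depends on the measure through its moments alone; hence two
  solutions of one moment problem have the same polynomials of the second kind.\<close>

lemma E_altdef: "E q = (\<Sum>i\<le>degree q. coeff q i * of_real (\<integral>x. x ^ i \<partial>M))"
proof -
  have "(\<integral>x. complex_of_real x ^ i \<partial>M) = of_real (\<integral>x. x ^ i \<partial>M)" for i
    using integral_complex_of_real[of M "\<lambda>x. x ^ i"] by simp
  then show ?thesis
    unfolding E_def poly_altdef by (subst Bochner_Integration.integral_sum) (auto intro!: integrable_of_real_power)
qed

lemma E_add: "E (q + r) = E q + E r"
  unfolding E_def poly_add by (intro Bochner_Integration.integral_add integrable_poly)

lemma E_diff: "E (q - r) = E q - E r"
  unfolding E_def poly_diff by (intro Bochner_Integration.integral_diff integrable_poly)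

lemma E_smult: "E (smult a q) = a * E q"
  unfolding E_def by simp

lemma E_0 [simp]: "E 0 = 0"
  unfolding E_def by simp

lemma E_sum: "E (\<Sum>i\<in>A. f i) = (\<Sum>i\<in>A. E (f i))"
  by (induction A rule: infinite_finite_induct) (simp_all add: E_add)

lemma degree_cp [simp]: "degree (cp n) = n"
  using orthonormal by (subst degree_map_poly) (auto simp: orthonormal_polys_def)

lemma coeff_cp_pos: "coeff (p n) n > 0"
  using orthonormal unfolding orthonormal_polys_def by metis

lemma E_cp_mult: "E (cp m * cp n) = of_bool (m = n)"
proof -
  have "E (cp m * cp n) = of_real (\<integral>x. poly (p m) x * poly (p n) x \<partial>M)"
    unfolding E_def poly_mult poly_map_poly_of_real of_real_mult[symmetric]
    by (rule integral_complex_of_real)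
  then show ?thesis using orthonormal by (simp add: orthonormal_polys_def)
qed

text \<open>The hypothesis expresses degree below \<open>n\<close> in a form that forces
  \<open>q = 0\<close> for \<open>n = 0\<close>. Subtracting a multiple of \<open>cp n\<close>
  removes the top coefficient.\<close>

lemma span_cp:
  assumes "\<And>i. i \<ge> n \<Longrightarrow> coeff q i = 0"
  shows "\<exists>c. q = (\<Sum>k<n. smult (c k) (cp k))"
  using assms
proof (induction n arbitrary: q)
  case 0
  then show ?case by (auto intro: poly_eqI)
next
  case (Suc n)
  define b where "b = coeff q n / of_real (coeff (p n) n)"
  have "coeff (q - smult b (cp n)) i = 0" if "i \<ge> n" for i
  proof (cases "i = n")
    case True
    then show ?thesis using coeff_cp_pos[of n] by (simp add: b_def coeff_map_poly)
  next
    case False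
    then have "coeff (cp n) i = 0" using that by (intro coeff_eq_0) simp
    then show ?thesis using Suc.prems[of i] False that by simp
  qed
  from Suc.IH[OF this] obtain c where c: "q - smult b (cp n) = (\<Sum>k<n. smult (c k) (cp k))" by blast
  have "q = (\<Sum>k<Suc n. smult ((c(n := b)) k) (cp k))"
    using c by (simp add: algebra_simps)
  then show ?case by blast
qed

lemma orthonormal_expansion:
  assumes "\<And>i. i \<ge> n \<Longrightarrow> coeff q i = 0"
  shows "q = (\<Sum>k<n. smult (E (cp k * q)) (cp k))"
proof -
  obtain c where c: "q = (\<Sum>k<n. smult (c k) (cp k))" using span_cp[OF assms] by blast
  have "E (cp k * q) = c k" if "k < n" for k
  proof -
    have "E (cp k * q) = (\<Sum>j<n. c j * of_bool (k = j))"
      by (subst c) (simp add: sum_distrib_left E_sum E_smult E_cp_mult)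
    also have "\<dots> = c k" using that by (simp add: of_bool_def if_distrib sum.delta cong: if_cong)
    finally show ?thesis .
  qed
  then show ?thesis by (subst c) (auto intro!: sum.cong)
qed

lemma E_mult_cp_eq_0:
  assumes "\<And>i. i \<ge> n \<Longrightarrow> coeff q i = 0"
  shows "E (q * cp n) = 0"
proof -
  obtain c where "q = (\<Sum>k<n. smult (c k) (cp k))" using span_cp[OF assms] by blast
  then have "E (q * cp n) = (\<Sum>k<n. c k * of_bool (k = n))"
    by (simp add: sum_distrib_right E_sum E_smult E_cp_mult)
  then show ?thesis by simp
qed

text \<open>Symmetry of the difference quotient moves the integration variable from the point of
  division to the argument, so the integrand becomes a polynomial to which \<open>E\<close>
  applies.\<close>

lemma polyQ_eq: "polyQ M p n z = E (synthetic_div (cp n) z)"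
  unfolding polyQ_def E_def by (simp add: poly_synthetic_div_commute)

lemma coeff_synthetic_div_eq_0: "coeff (synthetic_div (cp n) z) i = 0" if "i \<ge> n"
proof (cases n)
  case 0
  then have "synthetic_div (cp n) z = 0" by (simp add: synthetic_div_eq_0_iff)
  then show ?thesis by simp
next
  case (Suc m)
  then show ?thesis using that by (intro coeff_eq_0) (simp add: degree_synthetic_div)
qed

text \<open>For \<open>k < n\<close> these are the coefficients of the difference quotient of
  \<open>cp n\<close> at \<open>z\<close> in the orthonormal basis, as the next two lemmas
  show.\<close>

abbreviation kern :: "complex \<Rightarrow> nat \<Rightarrow> nat \<Rightarrow> complex" where
  "kern z n k \<equiv> polyP p k z * polyQ M p n z - polyP p n z * polyQ M p k z"

text \<open>The product differs from a combination of the two difference quotients only by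
  \<open>?s k * cp n\<close>, which integrates to zero because \<open>?s k\<close> has degree below
  \<open>n\<close>. The combination integrates to \<open>kern z n k\<close>.\<close>

lemma E_cp_mult_synthetic_div:
  assumes "k < n"
  shows "E (cp k * synthetic_div (cp n) z) = kern z n k"
proof -
  let ?s = "\<lambda>n. synthetic_div (cp n) z"
  have "cp k * ?s n = ?s k * cp n + smult (poly (cp k) z) (?s n) - smult (poly (cp n) z) (?s k)"
  proof (rule pCons_mult_cancel[of z])
    let ?L = "[:- z, 1:]"
    have "?L * (cp k * ?s n) = cp k * (?L * ?s n)" by (simp only: mult.left_commute)
    also have "\<dots> = cp k * cp n - smult (poly (cp n) z) (cp k)"
      unfolding linear_mult_synthetic_div by (simp add: algebra_simps)
    also have "\<dots> = (?L * ?s k) * cp n + smult (poly (cp k) z) (?L * ?s n) - smult (poly (cp n) z) (?L * ?s k)"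
      unfolding linear_mult_synthetic_div by (simp add: algebra_simps smult_diff_right)
    also have "\<dots> = ?L * (?s k * cp n + smult (poly (cp k) z) (?s n) - smult (poly (cp n) z) (?s k))"
      by (simp only: distrib_left right_diff_distrib mult_smult_right mult.assoc)
    finally show "?L * (cp k * ?s n) = \<dots>" .
  qed
  moreover have "E (?s k * cp n) = 0"
    using assms by (intro E_mult_cp_eq_0 coeff_synthetic_div_eq_0) auto
  ultimately show ?thesis
    by (simp add: E_add E_diff E_smult polyQ_eq polyP_def)
qed

lemma synthetic_div_expansion:
  "synthetic_div (cp n) z = (\<Sum>k<n. smult (kern z n k) (cp k))"
proof -
  have "synthetic_div (cp n) z = (\<Sum>k<n. smult (E (cp k * synthetic_div (cp n) z)) (cp k))"
    by (intro orthonormal_expansion coeff_synthetic_div_eq_0)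
  also have "\<dots> = (\<Sum>k<n. smult (kern z n k) (cp k))"
    by (intro sum.cong refl arg_cong2[where f = smult] E_cp_mult_synthetic_div) simp
  finally show ?thesis .
qed

text \<open>The expansion of the difference quotient at \<open>z0\<close>, evaluated at
  \<open>z\<close>. It is a discrete Volterra equation: only indices below \<open>n\<close> enter.
  With \<open>z0 = 0\<close> it yields the Christoffel-Darboux recurrence, with a general
  \<open>z0\<close> it feeds the Gronwall estimate.\<close>

lemma polyP_change_point:
  "polyP p n z = polyP p n z0 + (z - z0) * (\<Sum>k<n. kern z0 n k * polyP p k z)"
proof -
  have "polyP p n z = polyP p n z0 + (z - z0) * poly (synthetic_div (cp n) z0) z"
    unfolding polyP_def by (rule poly_synthetic_div)
  then show ?thesis by (simp add: synthetic_div_expansion poly_sum polyP_def)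
qed

text \<open>Applying \<open>E\<close> to the relation of second divided differences gives the same
  kernel as for \<open>polyP\<close>, so both families can be treated alike.\<close>

lemma polyQ_change_point:
  "polyQ M p n z = polyQ M p n z0 + (z - z0) * (\<Sum>k<n. kern z0 n k * polyQ M p k z)"
proof -
  have "polyQ M p n z = polyQ M p n z0 + (z - z0) * E (synthetic_div (synthetic_div (cp n) z0) z)"
    unfolding polyQ_eq by (subst synthetic_div_change_point[of _ _ z0]) (simp only: E_add E_smult)
  also have "synthetic_div (synthetic_div (cp n) z0) z
      = (\<Sum>k<n. smult (kern z0 n k) (synthetic_div (cp k) z))"
    by (subst synthetic_div_expansion) (simp only: synthetic_div_sum synthetic_div_smult)
  finally show ?thesis by (simp add: E_sum E_smult polyQ_eq)
qed

lemma polyP_cnj: "polyP p n (cnj z) = cnj (polyP p n z)"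
  by (simp add: polyP_def poly_map_poly_of_real_cnj)

lemma synthetic_div_map_poly_of_real:
  "synthetic_div (map_poly complex_of_real q) (of_real x) = map_poly of_real (synthetic_div q x)"
  by (induction q) (simp_all add: map_poly_pCons poly_map_poly_of_real)

lemma polyQ_cnj: "polyQ M p n (cnj z) = cnj (polyQ M p n z)"
  unfolding polyQ_def Bochner_Integration.integral_cnj[symmetric]
  by (simp only: synthetic_div_map_poly_of_real poly_map_poly_of_real_cnj)

lemma holomorphic_polyP: "polyP p n holomorphic_on UNIV"
  unfolding polyP_def[abs_def] poly_altdef by (intro holomorphic_intros)

text \<open>\<open>polyQ\<close> is given by an integral, but the equation with base point 0
  expresses it through constants and earlier members.\<close>

lemma holomorphic_polyQ: "polyQ M p n holomorphic_on UNIV"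
proof (induction n rule: less_induct)
  case (less n)
  have "(\<lambda>z. polyQ M p n 0 + (z - 0) * (\<Sum>k<n. kern 0 n k * polyQ M p k z)) holomorphic_on UNIV"
    by (intro holomorphic_intros less.IH) simp
  also have "(\<lambda>z. polyQ M p n 0 + (z - 0) * (\<Sum>k<n. kern 0 n k * polyQ M p k z)) = polyQ M p n"
    by (rule ext) (rule polyQ_change_point[symmetric])
  finally show ?case .
qed

section \<open>The Cauchy kernel and Bessel's inequality\<close>

lemma prob_UNIV: "prob UNIV = 1"
  using prob_space by simp

definition cauchy_transform :: "complex \<Rightarrow> complex" where
  "cauchy_transform z = (\<integral>x. 1 / (of_real x - z) \<partial>M)"

definition kernel_energy :: "complex \<Rightarrow> real" where
  "kernel_energy z = (\<integral>x. (norm (1 / (complex_of_real x - z)))\<^sup>2 \<partial>M)"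

context
  fixes z :: complex
  assumes z: "Im z \<noteq> 0"
begin

lemma of_real_ne: "complex_of_real x \<noteq> z"
  using z by auto

lemma norm_cauchy_kernel_square_le: "(norm (1 / (complex_of_real x - z)))\<^sup>2 \<le> (1 / \<bar>Im z\<bar>)\<^sup>2"
  using norm_cauchy_kernel_le[OF z] by (intro power_mono) auto

lemma integrable_norm_cauchy_kernel_square: "integrable M (\<lambda>x. (norm (1 / (complex_of_real x - z)))\<^sup>2)"
  by (rule integrable_const_bound[where B = "(1 / \<bar>Im z\<bar>)\<^sup>2"])
     (use norm_cauchy_kernel_square_le in auto)

lemma norm_cauchy_transform_le: "norm (cauchy_transform z) \<le> 1 / \<bar>Im z\<bar>"
proof -
  have "norm (cauchy_transform z) \<le> (\<integral>x. norm (1 / (complex_of_real x - z)) \<partial>M)"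
    unfolding cauchy_transform_def by (rule integral_norm_bound)
  also have "\<dots> \<le> (\<integral>x. 1 / \<bar>Im z\<bar> \<partial>M)"
    by (intro integral_mono integrable_norm integrable_cauchy_kernel z norm_cauchy_kernel_le) auto
  finally show ?thesis by (simp add: prob_UNIV)
qed

lemma kernel_energy_le: "kernel_energy z \<le> (1 / \<bar>Im z\<bar>)\<^sup>2"
proof -
  have "kernel_energy z \<le> (\<integral>x. (1 / \<bar>Im z\<bar>)\<^sup>2 \<partial>M)"
    unfolding kernel_energy_def by (intro integral_mono integrable_norm_cauchy_kernel_square norm_cauchy_kernel_square_le) auto
  then show ?thesis by (simp add: prob_UNIV)
qed

text \<open>The identity holds pointwise for the integrand. Later it shows that the transform does
  not vanish and bounds it from below.\<close>

lemma Im_cauchy_transform: "Im (cauchy_transform z) = Im z * kernel_energy z"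
proof -
  have "Im (1 / (complex_of_real x - z)) = Im z * (norm (1 / (complex_of_real x - z)))\<^sup>2" for x
    by (simp add: Im_divide norm_divide power_divide cmod_power2)
  then show ?thesis
    unfolding cauchy_transform_def kernel_energy_def by (simp only: integral_Im[OF integrable_cauchy_kernel[OF z], symmetric] integral_mult_right_zero)
qed

lemma integrable_cauchy_kernel_mult_poly: "integrable M (\<lambda>x. 1 / (of_real x - z) * poly q (of_real x))"
proof (rule Bochner_Integration.integrable_bound)
  show "integrable M (\<lambda>x. 1 / \<bar>Im z\<bar> * norm (poly q (complex_of_real x)))"
    by (intro integrable_mult_right integrable_norm integrable_poly)
  show "AE x in M. norm (1 / (of_real x - z) * poly q (of_real x))
      \<le> norm (1 / \<bar>Im z\<bar> * norm (poly q (complex_of_real x)))"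
    unfolding norm_mult by (intro AE_I2 mult_mono) (use norm_cauchy_kernel_le[OF z] in auto)
  have "poly q \<circ> complex_of_real \<in> borel_measurable M"
    using borel_measurable_integrable[OF integrable_poly[of q]] by (simp add: comp_def)
  then show "(\<lambda>x. 1 / (of_real x - z) * poly q (of_real x)) \<in> borel_measurable M"
    by (auto simp: comp_def)
qed

text \<open>Splitting \<open>cp n\<close> into its value at \<open>z\<close> and
  \<open>x - z\<close> times the difference quotient computes the Fourier coefficient of the Cauchy
  kernel.\<close>

lemma cauchy_kernel_mult_cp:
  "(\<integral>x. 1 / (of_real x - z) * poly (cp n) (of_real x) \<partial>M) = cauchy_transform z * polyP p n z + polyQ M p n z"
proof -
  have "1 / (of_real x - z) * poly (cp n) (of_real x)
      = polyP p n z * (1 / (of_real x - z)) + poly (synthetic_div (cp n) z) (of_real x)" for x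
    using of_real_ne[of x] poly_synthetic_div[of "cp n" "of_real x" z]
    by (simp add: polyP_def field_simps)
  then have "(\<integral>x. 1 / (of_real x - z) * poly (cp n) (of_real x) \<partial>M)
      = (\<integral>x. polyP p n z * (1 / (of_real x - z)) + poly (synthetic_div (cp n) z) (of_real x) \<partial>M)"
    by presburger
  also have "\<dots> = (\<integral>x. polyP p n z * (1 / (of_real x - z)) \<partial>M) + E (synthetic_div (cp n) z)"
    unfolding E_def
    by (intro Bochner_Integration.integral_add integrable_mult_right integrable_cauchy_kernel z integrable_poly)
  also have "\<dots> = cauchy_transform z * polyP p n z + polyQ M p n z"
    unfolding polyQ_eq cauchy_transform_def by (simp only: integral_mult_right_zero mult.commute)
  finally show ?thesis .
qed

text \<open>The squared distance in L2 from the kernel to its projection \<open>h\<close> onto the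
  first \<open>N\<close> polynomials is nonnegative and equals
  \<open>kernel_energy z - S\<close>.\<close>

lemma bessel: "(\<Sum>n<N. (norm (cauchy_transform z * polyP p n z + polyQ M p n z))\<^sup>2) \<le> kernel_energy z"
proof -
  define c where "c n = cauchy_transform z * polyP p n z + polyQ M p n z" for n
  define h where "h = (\<Sum>n<N. smult (c n) (cp n))"
  \<comment> \<open>Conjugated coefficients give a polynomial that agrees with \<open>cnj\<close> of
    \<open>h\<close> on the real line, so that products remain polynomial integrands.\<close>
  define h' where "h' = (\<Sum>n<N. smult (cnj (c n)) (cp n))"
  define S where "S = (\<Sum>n<N. (norm (c n))\<^sup>2)"
  let ?f = "\<lambda>x. 1 / (complex_of_real x - z)"
  have h'_eq: "poly h' (of_real x) = cnj (poly h (of_real x))" for x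
    by (simp add: h_def h'_def poly_sum poly_map_poly_of_real)
  have c_int: "(\<integral>x. ?f x * poly (cp n) (of_real x) \<partial>M) = c n" for n
    unfolding c_def by (rule cauchy_kernel_mult_cp)
  have fh': "(\<integral>x. ?f x * poly h' (of_real x) \<partial>M) = of_real S"
  proof -
    have "(\<integral>x. ?f x * poly h' (of_real x) \<partial>M)
        = (\<integral>x. (\<Sum>n<N. cnj (c n) * (?f x * poly (cp n) (of_real x))) \<partial>M)"
      unfolding h'_def by (simp add: poly_sum sum_distrib_left mult_ac)
    also have "\<dots> = (\<Sum>n<N. cnj (c n) * c n)"
      by (subst Bochner_Integration.integral_sum)
         (simp_all only: integral_mult_right_zero c_int integrable_mult_right integrable_cauchy_kernel_mult_poly)
    also have "\<dots> = of_real S"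
      unfolding S_def of_real_sum by (simp only: complex_norm_square mult.commute)
    finally show ?thesis .
  qed
  have hh': "(\<integral>x. poly h (of_real x) * poly h' (of_real x) \<partial>M) = of_real S"
  proof -
    have "(\<integral>x. poly h (of_real x) * poly h' (of_real x) \<partial>M) = E (h * h')"
      by (simp add: E_def)
    also have "\<dots> = (\<Sum>n<N. \<Sum>m<N. c n * (cnj (c m) * of_bool (n = m)))"
      unfolding h_def h'_def by (simp add: sum_product E_sum E_smult E_cp_mult mult.assoc mult.left_commute)
    also have "\<dots> = (\<Sum>n<N. c n * cnj (c n))"
      by (intro sum.cong refl) (simp add: of_bool_def if_distrib sum.delta cong: if_cong)
    also have "\<dots> = of_real S"
      unfolding S_def of_real_sum by (simp only: complex_norm_square)
    finally show ?thesis .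
  qed
  have fh_int: "integrable M (\<lambda>x. ?f x * poly h' (of_real x))"
    by (rule integrable_cauchy_kernel_mult_poly)
  have hh_int: "integrable M (\<lambda>x. poly h (of_real x) * poly h' (of_real x))"
    using integrable_poly[of "h * h'"] by simp
  note i1 = integrable_norm_cauchy_kernel_square
  have i2: "integrable M (\<lambda>x. 2 * Re (?f x * poly h' (of_real x)))"
    by (intro integrable_mult_right integrable_Re fh_int)
  have i3: "integrable M (\<lambda>x. Re (poly h (of_real x) * poly h' (of_real x)))"
    by (intro integrable_Re hh_int)
  have Re_fh: "(\<integral>x. Re (?f x * poly h' (of_real x)) \<partial>M) = S"
    using integral_Re[OF fh_int] fh' by simp
  have Re_hh: "(\<integral>x. Re (poly h (of_real x) * poly h' (of_real x)) \<partial>M) = S"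
    using integral_Re[OF hh_int] hh' by simp
  have expand: "(norm (?f x - poly h (of_real x)))\<^sup>2 = (norm (?f x))\<^sup>2
      - 2 * Re (?f x * poly h' (of_real x)) + Re (poly h (of_real x) * poly h' (of_real x))" for x
  proof -
    have "(norm (a - b))\<^sup>2 = (norm a)\<^sup>2 - 2 * Re (a * cnj b) + Re (b * cnj b)" for a b :: complex
      unfolding cmod_power2 by (simp add: power2_eq_square algebra_simps)
    then show ?thesis unfolding h'_eq by blast
  qed
  have "0 \<le> (\<integral>x. (norm (?f x - poly h (of_real x)))\<^sup>2 \<partial>M)" by simp
  also have "\<dots> = (\<integral>x. (norm (?f x))\<^sup>2
      - 2 * Re (?f x * poly h' (of_real x)) + Re (poly h (of_real x) * poly h' (of_real x)) \<partial>M)"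
    unfolding expand ..
  also have "\<dots> = (\<integral>x. (norm (?f x))\<^sup>2 \<partial>M) - (\<integral>x. 2 * Re (?f x * poly h' (of_real x)) \<partial>M)
      + (\<integral>x. Re (poly h (of_real x) * poly h' (of_real x)) \<partial>M)"
    by (simp only: Bochner_Integration.integral_add[OF Bochner_Integration.integrable_diff[OF i1 i2] i3]
        Bochner_Integration.integral_diff[OF i1 i2])
  also have "\<dots> = kernel_energy z - 2 * S + S"
    by (simp only: integral_mult_right_zero Re_fh Re_hh kernel_energy_def)
  finally show ?thesis unfolding S_def c_def by simp
qed

end

text \<open>Since \<open>norm (x - z) \<le> (1 + \<bar>x\<bar>) * (1 + norm z)\<close>, the
  dependence on \<open>z\<close> factors out. The constant \<kappa> is the integral of
  \<open>?g\<close>, positive because \<open>?g\<close> is positive and the measure is a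
  probability.\<close>

lemma kernel_energy_ge: "\<exists>\<kappa>>0. \<forall>z. Im z \<noteq> 0 \<longrightarrow> \<kappa> / (1 + norm z)\<^sup>2 \<le> kernel_energy z"
proof (intro exI conjI allI impI)
  let ?g = "\<lambda>x :: real. 1 / (1 + \<bar>x\<bar>)\<^sup>2"
  have g_int: "integrable M ?g"
    by (rule integrable_const_bound[where B = 1]) (auto simp: divide_simps)
  have "(\<integral>x. ?g x \<partial>M) \<noteq> 0"
  proof
    assume "(\<integral>x. ?g x \<partial>M) = 0"
    then have "AE x in M. ?g x = 0"
      using integral_nonneg_eq_0_iff_AE[OF g_int] by auto
    then have "AE x in M. False"
      by eventually_elim (auto simp: add_nonneg_eq_0_iff)
    then show False using prob_space by simp
  qed
  moreover have "(\<integral>x. ?g x \<partial>M) \<ge> 0" by simp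
  ultimately show "(\<integral>x. ?g x \<partial>M) > 0" by linarith
  fix z :: complex assume z: "Im z \<noteq> 0"
  have "?g x / (1 + norm z)\<^sup>2 \<le> (norm (1 / (complex_of_real x - z)))\<^sup>2" for x
  proof -
    have "norm (complex_of_real x - z) \<le> \<bar>x\<bar> + norm z"
      using norm_triangle_ineq4[of "complex_of_real x" z] by simp
    also have "\<dots> \<le> (1 + \<bar>x\<bar>) * (1 + norm z)" by (simp add: algebra_simps)
    finally have "1 / ((1 + \<bar>x\<bar>) * (1 + norm z)) \<le> 1 / norm (complex_of_real x - z)"
      using of_real_ne[OF z] by (intro divide_left_mono) (auto intro!: mult_pos_pos add_pos_nonneg)
    then have "(1 / ((1 + \<bar>x\<bar>) * (1 + norm z)))\<^sup>2 \<le> (1 / norm (complex_of_real x - z))\<^sup>2"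
      by (intro power_mono) auto
    then show ?thesis by (simp add: power_divide power_mult_distrib norm_divide)
  qed
  then have "(\<integral>x. ?g x / (1 + norm z)\<^sup>2 \<partial>M) \<le> kernel_energy z"
    unfolding kernel_energy_def by (intro integral_mono integrable_norm_cauchy_kernel_square z integrable_divide g_int)
  then show "(\<integral>x. ?g x \<partial>M) / (1 + norm z)\<^sup>2 \<le> kernel_energy z"
    by (simp only: integral_divide_zero)
qed

lemma polyP_0: "polyP p 0 z = 1"
proof -
  have deg: "degree (p 0) = 0" using orthonormal by (simp add: orthonormal_polys_def)
  then obtain a where a: "p 0 = [:a:]" by (rule degree_eq_zeroE)
  have "(\<integral>x. poly (p 0) x * poly (p 0) x \<partial>M) = 1"
    using orthonormal by (simp add: orthonormal_polys_def)
  then have "(a - 1) * (a + 1) = 0" using a by (simp add: prob_UNIV algebra_simps)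
  moreover have "a > 0" using coeff_cp_pos[of 0] a by simp
  ultimately have "a = 1" by simp
  then show ?thesis using a by (simp add: polyP_def map_poly_pCons)
qed

text \<open>A positive constant, which bounds the square sum of the \<open>polyQ\<close> from below;
  the member with index 0 is zero and cannot serve.\<close>

lemma polyQ_1: "polyQ M p 1 z = of_real (coeff (p 1) 1)"
proof -
  have "degree (p 1) = 1" using orthonormal by (simp add: orthonormal_polys_def)
  then obtain a b where "p 1 = [:a, b:]" by (metis degree1_coeffs)
  then show ?thesis by (simp add: polyQ_eq E_def map_poly_pCons prob_UNIV)
qed

end

text \<open>Cauchy-Schwarz turns the Volterra equation into
  \<open>norm (u n) ^ 2 \<le> c * d n ^ 2 * (1 + \<sigma> n)\<close>, where \<sigma> denotes the
  partial square sums and \<open>c = 2 * (1 + r^2 * E)\<close>. So \<open>1 + \<sigma> n\<close>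
  grows in each step by a factor of at most \<open>exp (c * d n ^ 2)\<close>, and the product of
  these factors stays bounded.\<close>

lemma discrete_gronwall_l2:
  fixes u :: "nat \<Rightarrow> complex" and a :: "nat \<Rightarrow> nat \<Rightarrow> complex"
  assumes u: "\<And>n. u n = v n + t * (\<Sum>k<n. a n k * u k)"
    and v: "\<And>n. norm (v n) \<le> d n" and a: "\<And>n k. norm (a n k) \<le> d n * d k"
    and d: "\<And>N. (\<Sum>n<N. (d n)\<^sup>2) \<le> E" and t: "norm t \<le> r"
  shows "(\<Sum>n<N. (norm (u n))\<^sup>2) \<le> exp (2 * (1 + r\<^sup>2 * E) * E)"
proof -
  define \<sigma> where "\<sigma> n = (\<Sum>k<n. (norm (u k))\<^sup>2)" for n
  have d0: "d n \<ge> 0" for n using v[of n] norm_ge_zero order_trans by blast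
  have E0: "E \<ge> 0" using d[of 0] by simp
  have \<sigma>0: "\<sigma> n \<ge> 0" for n unfolding \<sigma>_def by (simp add: sum_nonneg)
  have r0: "r \<ge> 0" using t norm_ge_zero order_trans by blast
  have step: "(norm (u n))\<^sup>2 \<le> 2 * (1 + r\<^sup>2 * E) * (d n)\<^sup>2 * (1 + \<sigma> n)" for n
  proof -
    have "norm (\<Sum>k<n. a n k * u k) \<le> (\<Sum>k<n. d n * (\<bar>d k\<bar> * \<bar>norm (u k)\<bar>))"
    proof (rule order_trans[OF norm_sum], rule sum_mono)
      fix k
      have "norm (a n k * u k) \<le> d n * d k * norm (u k)"
        unfolding norm_mult by (intro mult_right_mono a) auto
      then show "norm (a n k * u k) \<le> d n * (\<bar>d k\<bar> * \<bar>norm (u k)\<bar>)" using d0[of k] by simp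
    qed
    also have "\<dots> \<le> d n * (L2_set d {..<n} * L2_set (\<lambda>k. norm (u k)) {..<n})"
      unfolding sum_distrib_left[symmetric] by (intro mult_left_mono L2_set_mult_ineq d0)
    also have "\<dots> \<le> d n * (sqrt E * sqrt (\<sigma> n))"
      unfolding L2_set_def \<sigma>_def
      by (intro mult_left_mono mult_right_mono real_sqrt_le_mono d d0) (simp add: sum_nonneg)
    finally have "norm (t * (\<Sum>k<n. a n k * u k)) \<le> r * (d n * (sqrt E * sqrt (\<sigma> n)))"
      unfolding norm_mult by (intro mult_mono t) (use r0 in auto)
    then have "norm (u n) \<le> d n + r * (d n * (sqrt E * sqrt (\<sigma> n)))"
      using v[of n] by (subst u) (meson add_mono norm_triangle_ineq order_trans)
    also have "\<dots> = d n * (1 + r * sqrt (E * \<sigma> n))" by (simp add: algebra_simps real_sqrt_mult)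
    finally have "(norm (u n))\<^sup>2 \<le> (d n * (1 + r * sqrt (E * \<sigma> n)))\<^sup>2" by (intro power_mono) auto
    also have "\<dots> = (d n)\<^sup>2 * (1 + r * sqrt (E * \<sigma> n))\<^sup>2" by (simp add: power_mult_distrib)
    also have "\<dots> \<le> (d n)\<^sup>2 * (2 * (1 + r\<^sup>2 * (E * \<sigma> n)))"
    proof (rule mult_left_mono)
      define s where "s = r * sqrt (E * \<sigma> n)"
      have "(1 + s)\<^sup>2 + (1 - s)\<^sup>2 = 2 * (1 + s\<^sup>2)" by (simp add: power2_eq_square algebra_simps)
      then have "(1 + s)\<^sup>2 \<le> 2 * (1 + s\<^sup>2)" using zero_le_power2[of "1 - s"] by linarith
      moreover have "s\<^sup>2 = r\<^sup>2 * (E * \<sigma> n)" using E0 \<sigma>0 by (simp add: s_def power_mult_distrib)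
      ultimately show "(1 + r * sqrt (E * \<sigma> n))\<^sup>2 \<le> 2 * (1 + r\<^sup>2 * (E * \<sigma> n))" by (simp add: s_def)
    qed simp
    also have "\<dots> \<le> (d n)\<^sup>2 * (2 * ((1 + r\<^sup>2 * E) * (1 + \<sigma> n)))"
      using E0 \<sigma>0[of n] by (intro mult_left_mono) (auto simp: algebra_simps)
    finally show ?thesis by (simp only: mult_ac)
  qed
  have "1 + \<sigma> n \<le> exp (2 * (1 + r\<^sup>2 * E) * (\<Sum>k<n. (d k)\<^sup>2))" for n
  proof (induction n)
    case 0
    then show ?case by (simp add: \<sigma>_def)
  next
    case (Suc n)
    let ?c = "2 * (1 + r\<^sup>2 * E)"
    have "1 + \<sigma> (Suc n) = 1 + \<sigma> n + (norm (u n))\<^sup>2" by (simp add: \<sigma>_def)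
    also have "\<dots> \<le> (1 + \<sigma> n) * (1 + ?c * (d n)\<^sup>2)" using step[of n] by (simp add: algebra_simps)
    also have "\<dots> \<le> exp (?c * (\<Sum>k<n. (d k)\<^sup>2)) * exp (?c * (d n)\<^sup>2)"
      using E0 by (intro mult_mono Suc.IH exp_ge_add_one_self) auto
    also have "\<dots> = exp (?c * (\<Sum>k<Suc n. (d k)\<^sup>2))" by (simp add: exp_add[symmetric] algebra_simps)
    finally show ?case .
  qed
  from this[of N] have "\<sigma> N \<le> exp (2 * (1 + r\<^sup>2 * E) * (\<Sum>k<N. (d k)\<^sup>2))" by linarith
  also have "\<dots> \<le> exp (2 * (1 + r\<^sup>2 * E) * E)"
    using E0 d[of N] by (auto intro!: mult_left_mono)
  finally show ?thesis by (simp add: \<sigma>_def)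
qed

text \<open>Cauchy's inequality for the derivative of order \<open>k\<close> at 0, which is
  \<open>fact k * coeff q k\<close>.\<close>

lemma norm_coeff_le_of_circle_bound:
  fixes q :: "complex poly"
  assumes "r > 0" and bound: "\<And>z. norm z = r \<Longrightarrow> norm (poly q z) \<le> B"
  shows "norm (coeff q k) * r ^ k \<le> B"
proof -
  have deriv: "deriv (poly q) = poly (pderiv q)" for q :: "complex poly"
    by (rule ext) (rule DERIV_imp_deriv[OF poly_DERIV])
  have "(deriv ^^ k) (poly q) = poly ((pderiv ^^ k) q)"
    by (induction k) (simp_all add: deriv)
  then have "(deriv ^^ k) (poly q) 0 = fact k * coeff q k"
    by (simp add: poly_0_coeff_0 coeff_higher_pderiv pochhammer_fact)
  moreover have "norm ((deriv ^^ k) (poly q) 0) \<le> fact k * B / r ^ k"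
    by (rule Cauchy_inequality) (use assms in \<open>auto intro!: holomorphic_intros continuous_intros\<close>)
  ultimately have "fact k * norm (coeff q k) \<le> fact k * B / r ^ k"
    by (simp add: norm_mult)
  then have "fact k * (norm (coeff q k) * r ^ k) \<le> fact k * B"
    using \<open>r > 0\<close> by (simp add: pos_le_divide_eq mult.assoc)
  then show ?thesis by simp
qed

lemma L2_set_sum_le:
  assumes "\<And>k i. k \<in> B \<Longrightarrow> 0 \<le> f k i" "finite B"
  shows "L2_set (\<lambda>i. \<Sum>k\<in>B. f k i) A \<le> (\<Sum>k\<in>B. L2_set (f k) A)"
  using assms(2,1)
proof (induction B rule: finite_induct)
  case (insert k B)
  have "L2_set (\<lambda>i. f k i + (\<Sum>k\<in>B. f k i)) A \<le> L2_set (f k) A + L2_set (\<lambda>i. \<Sum>k\<in>B. f k i) A"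
    by (rule L2_set_triangle_ineq)
  also have "\<dots> \<le> L2_set (f k) A + (\<Sum>k\<in>B. L2_set (f k) A)"
    using insert by (intro add_left_mono insert.IH) auto
  finally show ?case using insert by simp
qed (simp add: L2_set_def)

lemma norm_square_diff_le: "(norm (a - b))\<^sup>2 \<le> 2 * (norm a)\<^sup>2 + 2 * (norm b)\<^sup>2"
  for a b :: complex
proof -
  have "(norm (a - b))\<^sup>2 \<le> (norm a + norm b)\<^sup>2"
    by (intro power_mono norm_triangle_ineq4) auto
  also have "\<dots> \<le> 2 * (norm a)\<^sup>2 + 2 * (norm b)\<^sup>2"
    using sum_squares_bound[of "norm a" "norm b"] by (simp add: power2_sum)
  finally show ?thesis .
qed

section \<open>The indeterminate case\<close>

locale indeterminate_system = orthonormal_system +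
  fixes N :: "real measure"
  assumes N: "real_distribution N" and N_neq: "N \<noteq> M"
    and integrable_power_N: "integrable N (\<lambda>x. x ^ n)"
    and moments_eq: "(\<integral>x. x ^ n \<partial>N) = (\<integral>x. x ^ n \<partial>M)"
begin

lemma integral_poly_eq: "(\<integral>x. poly q x \<partial>N) = (\<integral>x. poly q x \<partial>M)"
  unfolding poly_altdef using integrable_power integrable_power_N
  by (subst (1 2) Bochner_Integration.integral_sum) (simp_all add: moments_eq)

lemma orthonormal_system_N: "orthonormal_system N p"
proof -
  interpret N: real_distribution N by (rule N)
  have eq: "(\<integral>x. poly (p m) x * poly (p n) x \<partial>N) = (\<integral>x. poly (p m) x * poly (p n) x \<partial>M)" for m n
    using integral_poly_eq[of "p m * p n"] by simp
  have "orthonormal_polys N p"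
    using orthonormal unfolding orthonormal_polys_def eq .
  then show ?thesis by unfold_locales (use integrable_power_N in auto)
qed

lemma polyQ_N: "polyQ N p n z = polyQ M p n z"
proof -
  interpret N: orthonormal_system N p by (rule orthonormal_system_N)
  show ?thesis by (simp add: N.polyQ_eq polyQ_eq N.E_altdef E_altdef moments_eq)
qed

text \<open>Where the Cauchy transforms of the two solutions differ, Bessel's inequality applies to
  both, with the same \<open>polyP\<close> and \<open>polyQ\<close>. The difference of the two
  coefficient sequences is a nonzero multiple of \<open>polyP p n z\<close>, which is therefore
  square summable; either inequality then controls \<open>polyQ\<close>.\<close>

lemma square_summable_at_point:
  "\<exists>z0 B. \<forall>k. (\<Sum>n<k. (norm (polyP p n z0) + norm (polyQ M p n z0))\<^sup>2) \<le> B"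
proof -
  interpret N: orthonormal_system N p by (rule orthonormal_system_N)
  obtain z where "Im z > 0" and ne: "cauchy_transform z \<noteq> N.cauchy_transform z"
    using cauchy_transform_unique[OF real_distribution_axioms N] N_neq unfolding cauchy_transform_def N.cauchy_transform_def by metis
  then have z: "Im z \<noteq> 0" by simp
  let ?w = "cauchy_transform z" and ?w' = "N.cauchy_transform z"
  let ?c = "\<lambda>n. ?w * polyP p n z + polyQ M p n z" and ?c' = "\<lambda>n. ?w' * polyP p n z + polyQ M p n z"
  define A where "A = 2 * (kernel_energy z + N.kernel_energy z) / (norm (?w - ?w'))\<^sup>2"
  define B where "B = 2 * kernel_energy z + 2 * ((norm ?w)\<^sup>2 * A)"
  have c: "(\<Sum>n<k. (norm (?c n))\<^sup>2) \<le> kernel_energy z" "(\<Sum>n<k. (norm (?c' n))\<^sup>2) \<le> N.kernel_energy z" for k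
    using bessel[OF z, of k] N.bessel[OF z, of k] by (simp_all add: polyQ_N)
  have P: "(\<Sum>n<k. (norm (polyP p n z))\<^sup>2) \<le> A" for k
  proof -
    have "(norm (?w - ?w'))\<^sup>2 * (norm (polyP p n z))\<^sup>2 \<le> 2 * (norm (?c n))\<^sup>2 + 2 * (norm (?c' n))\<^sup>2" for n
      using norm_square_diff_le[of "?c n" "?c' n"] by (simp add: norm_mult[symmetric] power_mult_distrib[symmetric] algebra_simps)
    then have "(\<Sum>n<k. (norm (?w - ?w'))\<^sup>2 * (norm (polyP p n z))\<^sup>2)
        \<le> (\<Sum>n<k. 2 * (norm (?c n))\<^sup>2 + 2 * (norm (?c' n))\<^sup>2)"
      by (intro sum_mono)
    also have "\<dots> = 2 * (\<Sum>n<k. (norm (?c n))\<^sup>2) + 2 * (\<Sum>n<k. (norm (?c' n))\<^sup>2)"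
      by (simp only: sum.distrib sum_distrib_left)
    also have "\<dots> \<le> 2 * (kernel_energy z + N.kernel_energy z)" using c[of k] by simp
    finally show ?thesis
      using ne unfolding A_def sum_distrib_left[symmetric] by (simp add: pos_le_divide_eq mult.commute)
  qed
  have Q: "(\<Sum>n<k. (norm (polyQ M p n z))\<^sup>2) \<le> B" for k
  proof -
    have "(norm (polyQ M p n z))\<^sup>2 \<le> 2 * (norm (?c n))\<^sup>2 + 2 * ((norm ?w)\<^sup>2 * (norm (polyP p n z))\<^sup>2)" for n
      using norm_square_diff_le[of "?c n" "?w * polyP p n z"] by (simp add: norm_mult power_mult_distrib)
    then have "(\<Sum>n<k. (norm (polyQ M p n z))\<^sup>2)
        \<le> (\<Sum>n<k. 2 * (norm (?c n))\<^sup>2 + 2 * ((norm ?w)\<^sup>2 * (norm (polyP p n z))\<^sup>2))"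
      by (intro sum_mono)
    also have "\<dots> = 2 * (\<Sum>n<k. (norm (?c n))\<^sup>2) + 2 * ((norm ?w)\<^sup>2 * (\<Sum>n<k. (norm (polyP p n z))\<^sup>2))"
      by (simp only: sum.distrib sum_distrib_left)
    also have "\<dots> \<le> B"
      unfolding B_def using c(1)[of k] P[of k] by (intro add_mono mult_left_mono) auto
    finally show ?thesis .
  qed
  have "(\<Sum>n<k. (norm (polyP p n z) + norm (polyQ M p n z))\<^sup>2) \<le> 2 * A + 2 * B" for k
  proof -
    have "(norm (polyP p n z) + norm (polyQ M p n z))\<^sup>2
        \<le> 2 * (norm (polyP p n z))\<^sup>2 + 2 * (norm (polyQ M p n z))\<^sup>2" for n
      using sum_squares_bound[of "norm (polyP p n z)" "norm (polyQ M p n z)"] by (simp add: power2_sum)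
    then have "(\<Sum>n<k. (norm (polyP p n z) + norm (polyQ M p n z))\<^sup>2)
        \<le> (\<Sum>n<k. 2 * (norm (polyP p n z))\<^sup>2 + 2 * (norm (polyQ M p n z))\<^sup>2)"
      by (intro sum_mono)
    also have "\<dots> = 2 * (\<Sum>n<k. (norm (polyP p n z))\<^sup>2) + 2 * (\<Sum>n<k. (norm (polyQ M p n z))\<^sup>2)"
      by (simp only: sum.distrib sum_distrib_left)
    also have "\<dots> \<le> 2 * A + 2 * B" using P[of k] Q[of k] by simp
    finally show ?thesis .
  qed
  then show ?thesis by blast
qed

text \<open>The kernel at \<open>z0\<close> is dominated by \<open>?d n * ?d k\<close> with
  \<open>?d\<close> square summable, so the Gronwall estimate applies to the change-of-point
  equations, uniformly for \<open>z\<close> in a disc.\<close>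

lemma
  shows l2_family_polyP: "l2_family (polyP p)"
    and l2_family_polyQ: "l2_family (polyQ M p)"
proof -
  obtain z0 B where B: "\<And>k. (\<Sum>n<k. (norm (polyP p n z0) + norm (polyQ M p n z0))\<^sup>2) \<le> B"
    using square_summable_at_point by blast
  let ?d = "\<lambda>n. norm (polyP p n z0) + norm (polyQ M p n z0)"
  have kern: "norm (kern z0 n k) \<le> ?d n * ?d k" for n k
  proof -
    have "norm (kern z0 n k) \<le> norm (polyP p k z0) * norm (polyQ M p n z0)
        + norm (polyP p n z0) * norm (polyQ M p k z0)"
      by (metis norm_mult norm_triangle_ineq4)
    also have "\<dots> \<le> ?d n * ?d k" by (simp add: algebra_simps)
    finally show ?thesis .
  qed
  have bound: "\<exists>C. \<forall>z k. norm z \<le> r \<longrightarrow> (\<Sum>n<k. (norm (u n z))\<^sup>2) \<le> C"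
    if u: "\<And>n z. u n z = u n z0 + (z - z0) * (\<Sum>k<n. kern z0 n k * u k z)"
      and le: "\<And>n. norm (u n z0) \<le> ?d n" for u r
  proof (intro exI allI impI)
    fix z :: complex and k assume "norm z \<le> r"
    then have "norm (z - z0) \<le> r + norm z0"
      using norm_triangle_ineq4[of z z0] by linarith
    show "(\<Sum>n<k. (norm (u n z))\<^sup>2) \<le> exp (2 * (1 + (r + norm z0)\<^sup>2 * B) * B)"
    proof (rule discrete_gronwall_l2)
      show "u n z = u n z0 + (z - z0) * (\<Sum>k<n. kern z0 n k * u k z)" for n by (rule u)
    qed (fact le kern B \<open>norm (z - z0) \<le> r + norm z0\<close>)+
  qed
  show "l2_family (polyP p)"
    by unfold_locales (use holomorphic_polyP bound[OF polyP_change_point] in auto)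
  show "l2_family (polyQ M p)"
    by unfold_locales (use holomorphic_polyQ bound[OF polyQ_change_point] in auto)
qed

end

text \<open>The recurrence is the change-of-point equation at 0: its free term, \<beta> times
  \<open>d\<close> minus \<alpha> times \<open>e\<close>, becomes \<open>polyP p n 0\<close> for
  \<open>e = -1\<close>, \<open>d = 0\<close>. The lower bound comes from
  \<open>polyP_0\<close>.\<close>

sublocale indeterminate_system \<subseteq>
  P: christoffel_darboux_family "polyP p" "\<lambda>n. polyP p n 0" "\<lambda>n. polyQ M p n 0" "-1" 0
proof -
  interpret P: l2_family "polyP p" by (rule l2_family_polyP)
  interpret Q: l2_family "polyQ M p" by (rule l2_family_polyQ)
  show "christoffel_darboux_family (polyP p) (\<lambda>n. polyP p n 0) (\<lambda>n. polyQ M p n 0) (- 1) 0"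
  proof
    show "\<exists>q>0. \<forall>z. P.l2 z \<ge> q"
      using P.norm_le_l2[of 0] by (intro exI[of _ 1]) (simp add: polyP_0)
    fix n z
    show "polyP p n z = polyQ M p n 0 * (0 + z * (\<Sum>k<n. polyP p k 0 * polyP p k z))
        - polyP p n 0 * (- 1 + z * (\<Sum>k<n. polyQ M p k 0 * polyP p k z))"
      by (subst polyP_change_point[of n z 0])
         (simp add: sum_subtractf sum_distrib_left algebra_simps)
  qed (auto intro: P.summable_square Q.summable_square polyP_cnj)
qed

text \<open>With \<open>e = 0\<close> and \<open>d = 1\<close> the free term becomes
  \<open>polyQ M p n 0\<close>.\<close>

sublocale indeterminate_system \<subseteq>
  Q: christoffel_darboux_family "polyQ M p" "\<lambda>n. polyP p n 0" "\<lambda>n. polyQ M p n 0" 0 1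
proof -
  interpret Q: l2_family "polyQ M p" by (rule l2_family_polyQ)
  show "christoffel_darboux_family (polyQ M p) (\<lambda>n. polyP p n 0) (\<lambda>n. polyQ M p n 0) 0 1"
  proof
    show "\<exists>q>0. \<forall>z. Q.l2 z \<ge> q"
      using Q.norm_le_l2[of 1] coeff_cp_pos[of 1]
      by (intro exI[of _ "coeff (p 1) 1"]) (simp add: polyQ_1 del: One_nat_def)
    fix n z
    show "polyQ M p n z = polyQ M p n 0 * (1 + z * (\<Sum>k<n. polyP p k 0 * polyQ M p k z))
        - polyP p n 0 * (0 + z * (\<Sum>k<n. polyQ M p k 0 * polyQ M p k z))"
      by (subst polyQ_change_point[of n z 0])
         (simp add: sum_subtractf sum_distrib_left algebra_simps)
  qed (auto intro: P.summable_square Q.summable_square polyQ_cnj P.summable_\<alpha>)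
qed

section \<open>Comparison of P and Q off the real axis\<close>

context indeterminate_system
begin

lemma fn_eqs:
  "fnA M p = Q.F" "fnB M p = P.F" "fnC M p = Q.G" "fnD p = P.G"
  "fnP p = (\<lambda>z. of_real (P.l2 z))" "fnQ M p = (\<lambda>z. of_real (Q.l2 z))"
  by (simp_all add: fun_eq_iff fnA_def fnB_def fnC_def fnD_def fnP_def fnQ_def
      P.F_def P.G_def Q.F_def Q.G_def P.l2_def Q.l2_def)

lemma L2_set_bessel:
  assumes "Im z \<noteq> 0"
  shows "L2_set (\<lambda>n. norm (cauchy_transform z * polyP p n z + polyQ M p n z)) {..<k} \<le> sqrt (kernel_energy z)"
  unfolding L2_set_def by (intro real_sqrt_le_mono bessel assms)

text \<open>Minkowski, writing \<open>polyQ\<close> as the Bessel coefficient minus the Cauchy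
  transform times \<open>polyP\<close>.\<close>

lemma Q_l2_le:
  assumes z: "Im z \<noteq> 0"
  shows "Q.l2 z \<le> norm (cauchy_transform z) * P.l2 z + sqrt (kernel_energy z)"
proof (rule Q.l2_le)
  fix k
  have "L2_set (\<lambda>n. norm (polyQ M p n z)) {..<k}
      \<le> L2_set (\<lambda>n. norm (cauchy_transform z) * norm (polyP p n z) + norm (cauchy_transform z * polyP p n z + polyQ M p n z)) {..<k}"
  proof (rule L2_set_mono)
    fix n
    show "norm (polyQ M p n z) \<le> norm (cauchy_transform z) * norm (polyP p n z) + norm (cauchy_transform z * polyP p n z + polyQ M p n z)"
      using norm_triangle_ineq4[of "cauchy_transform z * polyP p n z + polyQ M p n z" "cauchy_transform z * polyP p n z"]
      by (simp add: norm_mult)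
  qed simp
  also have "\<dots> \<le> L2_set (\<lambda>n. norm (cauchy_transform z) * norm (polyP p n z)) {..<k}
      + L2_set (\<lambda>n. norm (cauchy_transform z * polyP p n z + polyQ M p n z)) {..<k}"
    by (rule L2_set_triangle_ineq)
  also have "\<dots> \<le> norm (cauchy_transform z) * P.l2 z + sqrt (kernel_energy z)"
    unfolding L2_set_right_distrib[symmetric, OF norm_ge_zero]
    by (intro add_mono mult_left_mono P.L2_set_le_l2 L2_set_bessel z) simp
  finally show "L2_set (\<lambda>n. norm (polyQ M p n z)) {..<k} \<le> norm (cauchy_transform z) * P.l2 z + sqrt (kernel_energy z)" .
qed

lemma P_l2_le:
  assumes z: "Im z \<noteq> 0"
  shows "norm (cauchy_transform z) * P.l2 z \<le> Q.l2 z + sqrt (kernel_energy z)"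
proof -
  \<comment> \<open>The transform has to be divided out before \<open>P.l2_le\<close> applies. It is
    nonzero because its imaginary part is \<open>Im z\<close> times a positive energy.\<close>
  have W_pos: "norm (cauchy_transform z) > 0"
  proof -
    obtain \<kappa> where "\<kappa> > 0" "\<kappa> / (1 + norm z)\<^sup>2 \<le> kernel_energy z" using kernel_energy_ge z by blast
    moreover have "(1 + norm z)\<^sup>2 > 0" using norm_ge_zero[of z] by (intro zero_less_power) linarith
    ultimately have "kernel_energy z > 0" by (meson divide_pos_pos less_le_trans)
    then have "Im (cauchy_transform z) \<noteq> 0" using z by (simp add: Im_cauchy_transform)
    then show ?thesis by auto
  qed
  have "P.l2 z \<le> (Q.l2 z + sqrt (kernel_energy z)) / norm (cauchy_transform z)"
  proof (rule P.l2_le)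
    fix k
    have "norm (cauchy_transform z) * L2_set (\<lambda>n. norm (polyP p n z)) {..<k}
        = L2_set (\<lambda>n. norm (cauchy_transform z) * norm (polyP p n z)) {..<k}"
      by (rule L2_set_right_distrib) simp
    also have "\<dots> \<le> L2_set (\<lambda>n. norm (polyQ M p n z) + norm (cauchy_transform z * polyP p n z + polyQ M p n z)) {..<k}"
    proof (rule L2_set_mono)
      fix n
      show "norm (cauchy_transform z) * norm (polyP p n z) \<le> norm (polyQ M p n z) + norm (cauchy_transform z * polyP p n z + polyQ M p n z)"
        using norm_triangle_ineq4[of "cauchy_transform z * polyP p n z + polyQ M p n z" "polyQ M p n z"]
        by (simp add: norm_mult)
    qed simp
    also have "\<dots> \<le> L2_set (\<lambda>n. norm (polyQ M p n z)) {..<k}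
        + L2_set (\<lambda>n. norm (cauchy_transform z * polyP p n z + polyQ M p n z)) {..<k}"
      by (rule L2_set_triangle_ineq)
    also have "\<dots> \<le> Q.l2 z + sqrt (kernel_energy z)"
      by (intro add_mono Q.L2_set_le_l2 L2_set_bessel z)
    finally show "L2_set (\<lambda>n. norm (polyP p n z)) {..<k} \<le> (Q.l2 z + sqrt (kernel_energy z)) / norm (cauchy_transform z)"
      using W_pos by (simp add: pos_le_divide_eq mult.commute)
  qed
  then show ?thesis using W_pos by (simp add: pos_le_divide_eq mult.commute)
qed

text \<open>The Cauchy transform and the root of the energy are both at most
  \<open>1 / \<bar>Im z\<bar>\<close>. Multiplication by \<open>\<bar>Im z\<bar>\<close> leaves
  \<open>P.l2 z + 1\<close>, which is at most \<open>2 * P.l2 z\<close>.\<close>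

lemma fnQ_growth_le_fnP: "growth_le (fnQ M p) (fnP p)"
  unfolding fn_eqs
proof (rule Q.l2_growth_le[where C = 2 and m = 0])
  fix z :: complex assume "norm z \<ge> 1"
  have P1: "1 \<le> P.l2 z" using P.norm_le_l2[of 0 z] by (simp add: polyP_0)
  have "\<bar>Im z\<bar> * Q.l2 z \<le> 2 * P.l2 z"
  proof (cases "Im z = 0")
    case False
    then have "sqrt (kernel_energy z) \<le> 1 / \<bar>Im z\<bar>" by (intro real_le_lsqrt kernel_energy_le) auto
    moreover have "norm (cauchy_transform z) * P.l2 z \<le> 1 / \<bar>Im z\<bar> * P.l2 z"
      by (intro mult_right_mono norm_cauchy_transform_le False) simp
    ultimately have "Q.l2 z \<le> 1 / \<bar>Im z\<bar> * P.l2 z + 1 / \<bar>Im z\<bar>" using Q_l2_le[OF False] by linarith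
    then have "\<bar>Im z\<bar> * Q.l2 z \<le> \<bar>Im z\<bar> * (1 / \<bar>Im z\<bar> * P.l2 z + 1 / \<bar>Im z\<bar>)"
      by (intro mult_left_mono) auto
    then show ?thesis using False P1 by (simp add: algebra_simps)
  qed simp
  also have "\<dots> \<le> 2 * max_mod (\<lambda>z. of_real (P.l2 z)) (norm z)"
    by (intro mult_left_mono P.l2_le_max_mod) auto
  finally show "\<bar>Im z\<bar> * Q.l2 z \<le> 2 * norm z ^ 0 * max_mod (\<lambda>z. of_real (P.l2 z)) (norm z)" by simp
qed simp

text \<open>The transform is at least \<open>\<bar>Im z\<bar> * kernel_energy z\<close> in modulus,
  and the inverse energy grows at most like the square of \<open>norm z\<close>, whence
  \<open>m = 2\<close>.\<close>

lemma fnP_growth_le_fnQ: "growth_le (fnP p) (fnQ M p)"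
proof -
  obtain \<kappa> where \<kappa>: "\<kappa> > 0" "\<And>z. Im z \<noteq> 0 \<Longrightarrow> \<kappa> / (1 + norm z)\<^sup>2 \<le> kernel_energy z" using kernel_energy_ge by blast
  obtain q where q: "q > 0" "\<And>z. Q.l2 z \<ge> q" using Q.l2_bounded_below by blast
  \<comment> \<open>The first factor bounds \<open>1 + 1 / kernel_energy z\<close> up to
    \<open>norm z ^ 2\<close>; the second absorbs the term with
    \<open>sqrt (kernel_energy z)\<close>, since \<open>Q.l2 z \<ge> q\<close>.\<close>
  define C where "C = (1 + 4 / \<kappa>) * (1 + 1 / q)"
  have C0: "C > 0" unfolding C_def using \<kappa> q by (simp add: add_pos_pos)
  show ?thesis unfolding fn_eqs
  proof (rule P.l2_growth_le[where C = C and m = 2])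
    fix z :: complex assume z1: "norm z \<ge> 1"
    have "\<bar>Im z\<bar> * P.l2 z \<le> C * norm z ^ 2 * Q.l2 z"
    proof (cases "Im z = 0")
      case True
      then show ?thesis using C0 by simp
    next
      case False
      have "\<kappa> / (4 * (norm z)\<^sup>2) \<le> \<kappa> / (1 + norm z)\<^sup>2"
      proof (rule frac_le)
        have "(1 + norm z)\<^sup>2 \<le> (2 * norm z)\<^sup>2" using z1 by (intro power_mono) auto
        then show "(1 + norm z)\<^sup>2 \<le> 4 * (norm z)\<^sup>2" by (simp add: power_mult_distrib)
        show "0 < (1 + norm z)\<^sup>2" using z1 by (intro zero_less_power) linarith
      qed (use \<kappa> in auto)
      then have Ige: "\<kappa> / (4 * (norm z)\<^sup>2) \<le> kernel_energy z" using \<kappa>(2)[OF False] by linarith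
      moreover have "\<kappa> / (4 * (norm z)\<^sup>2) > 0" using \<kappa>(1) z1 by (intro divide_pos_pos mult_pos_pos zero_less_power) auto
      ultimately have Ipos: "kernel_energy z > 0" by linarith
      have invI: "1 / kernel_energy z \<le> 4 / \<kappa> * (norm z)\<^sup>2"
      proof -
        have "0 < (norm z)\<^sup>2" using z1 by (intro zero_less_power) linarith
        then have "\<kappa> \<le> kernel_energy z * (4 * (norm z)\<^sup>2)" using Ige by (simp add: pos_divide_le_eq)
        then show ?thesis using Ipos \<kappa>(1) by (simp add: field_simps)
      qed
      have "sqrt (kernel_energy z) \<le> 1 + kernel_energy z"
        using Ipos by (intro real_le_lsqrt) (auto simp: power2_eq_square algebra_simps)
      then have sq: "sqrt (kernel_energy z) / kernel_energy z \<le> 1 + 1 / kernel_energy z"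
        using Ipos by (simp add: field_simps)
      have Q1: "1 \<le> Q.l2 z / q" using q by (simp add: pos_le_divide_eq)
      have "\<bar>Im z\<bar> * kernel_energy z \<le> norm (cauchy_transform z)"
        using abs_Im_le_cmod[of "cauchy_transform z"] Ipos by (simp add: Im_cauchy_transform[OF False] abs_mult)
      then have "\<bar>Im z\<bar> * kernel_energy z * P.l2 z \<le> norm (cauchy_transform z) * P.l2 z" by (intro mult_right_mono) auto
      then have "\<bar>Im z\<bar> * P.l2 z * kernel_energy z \<le> Q.l2 z + sqrt (kernel_energy z)" using P_l2_le[OF False] by (simp add: mult_ac)
      then have "\<bar>Im z\<bar> * P.l2 z \<le> (Q.l2 z + sqrt (kernel_energy z)) / kernel_energy z" using Ipos by (simp add: pos_le_divide_eq)
      also have "\<dots> = 1 / kernel_energy z * Q.l2 z + sqrt (kernel_energy z) / kernel_energy z" by (simp add: add_divide_distrib)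
      also have "\<dots> \<le> (1 + 1 / kernel_energy z) * Q.l2 z + (1 + 1 / kernel_energy z) * (Q.l2 z / q)"
      proof (rule add_mono)
        show "1 / kernel_energy z * Q.l2 z \<le> (1 + 1 / kernel_energy z) * Q.l2 z" by (intro mult_right_mono) auto
        have "sqrt (kernel_energy z) / kernel_energy z \<le> (1 + 1 / kernel_energy z) * 1" using sq by simp
        also have "\<dots> \<le> (1 + 1 / kernel_energy z) * (Q.l2 z / q)"
          using Q1 Ipos by (intro mult_left_mono) auto
        finally show "sqrt (kernel_energy z) / kernel_energy z \<le> (1 + 1 / kernel_energy z) * (Q.l2 z / q)" .
      qed
      also have "\<dots> = (1 + 1 / kernel_energy z) * ((1 + 1 / q) * Q.l2 z)" by (simp add: algebra_simps)
      also have "\<dots> \<le> ((1 + 4 / \<kappa>) * (norm z)\<^sup>2) * ((1 + 1 / q) * Q.l2 z)"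
      proof (rule mult_right_mono)
        have "1 \<le> (norm z)\<^sup>2" using z1 by simp
        then show "1 + 1 / kernel_energy z \<le> (1 + 4 / \<kappa>) * (norm z)\<^sup>2" using invI by (simp add: distrib_right)
        show "0 \<le> (1 + 1 / q) * Q.l2 z" using q by (intro mult_nonneg_nonneg) auto
      qed
      also have "\<dots> = C * norm z ^ 2 * Q.l2 z" by (simp add: C_def mult_ac)
      finally show ?thesis .
    qed
    also have "\<dots> \<le> C * norm z ^ 2 * max_mod (\<lambda>z. of_real (Q.l2 z)) (norm z)"
      using C0 by (intro mult_left_mono Q.l2_le_max_mod) auto
    finally show "\<bar>Im z\<bar> * P.l2 z \<le> C * norm z ^ 2 * max_mod (\<lambda>z. of_real (Q.l2 z)) (norm z)" .
  qed (use C0 in auto)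
qed

section \<open>Coefficient norms and the function Phi\<close>

abbreviation MP :: "real \<Rightarrow> real" where "MP \<equiv> max_mod (\<lambda>z. of_real (P.l2 z))"

lemma MP_nonneg: "r \<ge> 0 \<Longrightarrow> MP r \<ge> 0"
  using P.l2_le_max_mod[of 0 r] P.l2_nonneg[of 0] by (simp del: P.l2_nonneg)

text \<open>The combination \<open>f\<close> of the \<open>cp n\<close>, weighted by their own
  coefficients of index \<open>k\<close>, has \<open>s^2\<close> as coefficient of that index and is
  bounded by \<open>s * MP r\<close> on the circle. Cauchy's estimate and division by
  \<open>s\<close> give the claim.\<close>

lemma L2_set_coeff_le:
  assumes "r > 0"
  shows "L2_set (\<lambda>n. coeff (p n) k) {..<m} * r ^ k \<le> MP r"
proof -
  define s where "s = L2_set (\<lambda>n. coeff (p n) k) {..<m}"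
  define f where "f = (\<Sum>n<m. smult (of_real (coeff (p n) k)) (cp n))"
  have s0: "s \<ge> 0" by (simp add: s_def)
  have "coeff f k = of_real (s\<^sup>2)"
    by (simp add: f_def s_def coeff_sum coeff_map_poly L2_set_def sum_nonneg power2_eq_square)
  moreover have "norm (coeff f k) * r ^ k \<le> s * MP r"
  proof (rule norm_coeff_le_of_circle_bound[OF \<open>r > 0\<close>])
    fix z :: complex assume z: "norm z = r"
    have "norm (poly f z) \<le> (\<Sum>n<m. \<bar>coeff (p n) k\<bar> * \<bar>norm (polyP p n z)\<bar>)"
      unfolding f_def poly_sum by (rule order_trans[OF norm_sum]) (simp add: norm_mult polyP_def)
    also have "\<dots> \<le> s * L2_set (\<lambda>n. norm (polyP p n z)) {..<m}"
      unfolding s_def by (rule L2_set_mult_ineq)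
    also have "\<dots> \<le> s * MP r"
      using z P.L2_set_le_l2 P.l2_le_max_mod by (intro mult_left_mono s0) (meson order_trans order_refl)
    finally show "norm (poly f z) \<le> s * MP r" .
  qed
  ultimately have "s * (s * r ^ k) \<le> s * MP r" by (simp add: norm_mult power2_eq_square mult.assoc)
  then show ?thesis
    using s0 MP_nonneg[of r] \<open>r > 0\<close> mult_le_cancel_left_pos[of s "s * r ^ k" "MP r"]
    unfolding s_def[symmetric] by (cases "s = 0") auto
qed

lemma summable_coeff_square: "summable (\<lambda>n. (coeff (p n) k)\<^sup>2)"
proof (rule bounded_imp_summable)
  fix n
  have "sqrt (\<Sum>i<Suc n. (coeff (p i) k)\<^sup>2) \<le> MP 1"
    using L2_set_coeff_le[of 1 k "Suc n"] by (simp only: L2_set_def) simp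
  then show "(\<Sum>i\<le>n. (coeff (p i) k)\<^sup>2) \<le> (MP 1)\<^sup>2"
    unfolding lessThan_Suc_atMost by (rule sqrt_le_D)
qed simp

text \<open>The polynomials of index below \<open>k\<close> have no coefficient of index
  \<open>k\<close>, so the sum may start at 0.\<close>

lemma coeff_norm_eq: "coeff_norm p k = sqrt (\<Sum>n. (coeff (p n) k)\<^sup>2)"
proof -
  have "coeff (p i) k = 0" if "i < k" for i
    using that orthonormal by (intro coeff_eq_0) (simp add: orthonormal_polys_def)
  then have "(\<Sum>i<k. (coeff (p i) k)\<^sup>2) = 0" by simp
  then show ?thesis
    using suminf_minus_initial_segment[OF summable_coeff_square, of k k]
    by (simp add: coeff_norm_def add.commute)
qed

lemma coeff_norm_nonneg: "coeff_norm p k \<ge> 0"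
  unfolding coeff_norm_eq by (simp add: suminf_nonneg summable_coeff_square)

lemma L2_set_le_coeff_norm: "L2_set (\<lambda>n. coeff (p n) k) {..<m} \<le> coeff_norm p k"
  unfolding coeff_norm_eq L2_set_def
  by (intro real_sqrt_le_mono sum_le_suminf summable_coeff_square) auto

lemma coeff_norm_le:
  assumes "r > 0"
  shows "coeff_norm p k * r ^ k \<le> MP r"
proof (rule LIMSEQ_le_const2)
  show "(\<lambda>m. L2_set (\<lambda>n. coeff (p n) k) {..<m} * r ^ k) \<longlonglongrightarrow> coeff_norm p k * r ^ k"
    unfolding coeff_norm_eq L2_set_def
    by (intro tendsto_intros summable_LIMSEQ summable_coeff_square)
qed (use L2_set_coeff_le[OF assms] in blast)

text \<open>The coefficient estimate at radius \<open>2 * r\<close> yields a geometric majorant of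
  ratio 1/2, whose sum supplies the factor 2.\<close>

lemma
  assumes "r > 0"
  shows summable_coeff_norm: "summable (\<lambda>k. coeff_norm p k * r ^ k)"
    and suminf_coeff_norm_le: "(\<Sum>k. coeff_norm p k * r ^ k) \<le> 2 * MP (2 * r)"
proof -
  have le: "coeff_norm p k * r ^ k \<le> MP (2 * r) * (1 / 2) ^ k" for k
    using coeff_norm_le[of "2 * r" k] assms by (simp add: power_mult_distrib power_divide field_simps)
  have geo: "summable (\<lambda>k. MP (2 * r) * (1 / 2) ^ k)" by (intro summable_mult summable_geometric) simp
  show s: "summable (\<lambda>k. coeff_norm p k * r ^ k)"
    by (rule summable_comparison_test'[OF geo]) (use le coeff_norm_nonneg assms in \<open>simp add: abs_mult\<close>)
  have "(\<Sum>k. coeff_norm p k * r ^ k) \<le> (\<Sum>k. MP (2 * r) * (1 / 2) ^ k)"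
    by (rule suminf_le[OF le s geo])
  also have "\<dots> = 2 * MP (2 * r)" by (subst suminf_mult) (auto simp: suminf_geometric)
  finally show "(\<Sum>k. coeff_norm p k * r ^ k) \<le> 2 * MP (2 * r)" .
qed

lemma norm_fnPhi_le:
  assumes "r > 0" "norm z \<le> r"
  shows "norm (fnPhi p z) \<le> (\<Sum>k. coeff_norm p k * r ^ k)"
proof -
  have le: "norm (of_real (coeff_norm p k) * z ^ k) \<le> coeff_norm p k * r ^ k" for k
    using assms coeff_norm_nonneg by (auto simp: norm_mult norm_power intro!: mult_left_mono power_mono)
  have s: "summable (\<lambda>k. norm (of_real (coeff_norm p k) * z ^ k))"
    by (rule summable_comparison_test'[OF summable_coeff_norm[OF assms(1)]]) (use le in simp)
  have "norm (fnPhi p z) \<le> (\<Sum>k. norm (of_real (coeff_norm p k) * z ^ k))"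
    unfolding fnPhi_def by (rule summable_norm[OF s])
  also have "\<dots> \<le> (\<Sum>k. coeff_norm p k * r ^ k)"
    by (rule suminf_le[OF le s summable_coeff_norm[OF assms(1)]])
  finally show ?thesis .
qed

text \<open>The coefficients are nonnegative, so Phi attains its maximum modulus on a disc at the
  positive real point.\<close>

lemma norm_fnPhi_of_real:
  assumes "r > 0"
  shows "norm (fnPhi p (of_real r)) = (\<Sum>k. coeff_norm p k * r ^ k)"
proof -
  have "fnPhi p (of_real r) = of_real (\<Sum>k. coeff_norm p k * r ^ k)"
    unfolding fnPhi_def suminf_of_real[OF summable_coeff_norm[OF assms]] by simp
  moreover have "(\<Sum>k. coeff_norm p k * r ^ k) \<ge> 0"
    using assms by (intro suminf_nonneg summable_coeff_norm mult_nonneg_nonneg coeff_norm_nonneg) auto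
  ultimately show ?thesis by simp
qed

text \<open>Minkowski: the sequence of the \<open>polyP p n z\<close> is dominated by the sum over
  \<open>k\<close> of \<open>r ^ k\<close> times the sequence of absolute coefficients of index
  \<open>k\<close>.\<close>

lemma P_l2_le_coeff_norm:
  assumes "r > 0" "norm z \<le> r"
  shows "P.l2 z \<le> (\<Sum>k. coeff_norm p k * r ^ k)"
proof (rule P.l2_le)
  fix m
  let ?f = "\<lambda>k n. r ^ k * \<bar>coeff (p n) k\<bar>"
  have "L2_set (\<lambda>n. norm (polyP p n z)) {..<m} \<le> L2_set (\<lambda>n. \<Sum>k<m. ?f k n) {..<m}"
  proof (rule L2_set_mono)
    fix n assume n: "n \<in> {..<m}"
    have "norm (polyP p n z) \<le> (\<Sum>k\<le>n. norm (coeff (cp n) k * z ^ k))"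
      unfolding polyP_def poly_altdef degree_cp by (rule norm_sum)
    also have "\<dots> \<le> (\<Sum>k\<le>n. ?f k n)"
      using assms by (intro sum_mono)
        (auto simp: norm_mult norm_power coeff_map_poly mult.commute intro!: mult_right_mono power_mono)
    \<comment> \<open>The range of \<open>k\<close> is made independent of \<open>n\<close>, so that
      Minkowski applies to a fixed finite family.\<close>
    also have "\<dots> \<le> (\<Sum>k<m. ?f k n)"
      using n assms by (intro sum_mono2) auto
    finally show "norm (polyP p n z) \<le> (\<Sum>k<m. ?f k n)" .
  qed simp
  also have "\<dots> \<le> (\<Sum>k<m. L2_set (?f k) {..<m})"
    using assms by (intro L2_set_sum_le) auto
  also have "\<dots> = (\<Sum>k<m. L2_set (\<lambda>n. coeff (p n) k) {..<m} * r ^ k)"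
    using assms by (intro sum.cong refl, subst L2_set_right_distrib[symmetric]) (auto simp: L2_set_def)
  also have "\<dots> \<le> (\<Sum>k<m. coeff_norm p k * r ^ k)"
    using assms by (intro sum_mono mult_right_mono L2_set_le_coeff_norm) auto
  also have "\<dots> \<le> (\<Sum>k. coeff_norm p k * r ^ k)"
    using assms coeff_norm_nonneg by (intro sum_le_suminf summable_coeff_norm) auto
  finally show "L2_set (\<lambda>n. norm (polyP p n z)) {..<m} \<le> (\<Sum>k. coeff_norm p k * r ^ k)" .
qed

lemma fnPhi_growth_le_fnP: "growth_le (fnPhi p) (fnP p)"
  unfolding fn_eqs
proof (rule growth_leI[where C = 2 and m = 0 and K = 2])
  fix r :: real assume "r \<ge> 1"
  then have r: "r > 0" by simp
  show "max_mod (fnPhi p) r \<le> 2 * r ^ 0 * MP (2 * r)"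
    using r norm_fnPhi_le[OF r] suminf_coeff_norm_le[OF r] by (intro max_mod_le) force+
qed auto

lemma fnP_growth_le_fnPhi: "growth_le (fnP p) (fnPhi p)"
  unfolding fn_eqs
proof (rule growth_leI[where C = 1 and m = 0 and K = 1])
  fix r :: real assume "r \<ge> 1"
  then have r: "r > 0" by simp
  have "(\<Sum>k. coeff_norm p k * r ^ k) \<le> max_mod (fnPhi p) r"
    unfolding norm_fnPhi_of_real[OF r, symmetric]
    by (rule norm_le_max_mod[OF norm_fnPhi_le[OF r]]) (use r in auto)
  then show "MP r \<le> 1 * r ^ 0 * max_mod (fnPhi p) (1 * r)"
    using r P_l2_le_coeff_norm[OF r] by (intro max_mod_le) force+
qed auto

section \<open>Growth of the six moment functions and of Phi\<close>

lemma moment_functions_growth: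
  assumes "f \<in> moment_functions M p"
  shows "growth_le f (fnPhi p)" "growth_le (fnPhi p) f"
proof -
  note PQ = fnP_growth_le_fnQ[unfolded fn_eqs] and QP = fnQ_growth_le_fnP[unfolded fn_eqs]
  \<comment> \<open>All comparisons pass through P, those for A and C by way of Q. The composition
    of \<open>PQ\<close> with \<open>QP\<close> supplies reflexivity for the case that
    \<open>f\<close> is P itself.\<close>
  note le_P = P.F_growth_le P.G_growth_le growth_le_trans[OF Q.F_growth_le QP]
    growth_le_trans[OF Q.G_growth_le QP] growth_le_trans[OF PQ QP] QP
  note P_le = P.l2_growth_le_F P.l2_growth_le_G growth_le_trans[OF PQ Q.l2_growth_le_F]
    growth_le_trans[OF PQ Q.l2_growth_le_G] growth_le_trans[OF PQ QP] PQ
  have "growth_le f (fnP p) \<and> growth_le (fnP p) f"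
    using assms unfolding moment_functions_def fn_eqs
    by (elim insertE emptyE) (simp_all only: le_P P_le simp_thms)
  then show "growth_le f (fnPhi p)" "growth_le (fnPhi p) f"
    using fnPhi_growth_le_fnP fnP_growth_le_fnPhi growth_le_trans by blast+
qed

end

text \<open>A space of infinite measure would have \<open>measure\<close> 0, so the zeroth moment 1
  forces total mass 1. Thus every solution is a probability measure.\<close>

lemma real_distribution_of_moment_problem:
  assumes "solves_moment_problem s \<nu>" "s 0 = 1"
  shows "real_distribution \<nu>"
proof -
  have "s 0 = (\<integral>x. x ^ 0 \<partial>\<nu>)"
    using assms unfolding solves_moment_problem_def by blast
  then have "measure \<nu> (space \<nu>) = 1" using assms(2) by simp
  then have "emeasure \<nu> (space \<nu>) = 1"
    using emeasure_eq_ennreal_measure[of \<nu> "space \<nu>"] measure_zero_top[of \<nu> "space \<nu>"] by force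
  then interpret prob_space \<nu> by (rule prob_spaceI)
  show ?thesis by unfold_locales (use assms in \<open>simp add: solves_moment_problem_def\<close>)
qed

theorem theorem6p3:
  fixes s :: "nat \<Rightarrow> real" and \<mu> :: "real measure" and p :: "nat \<Rightarrow> real poly"
  assumes "normalized_hamburger s \<mu>"
    and "indeterminate s"
    and "orthonormal_polys \<mu> p"
    and "problem_has growth_order \<mu> p 0"
    and "problem_has log_order \<mu> p 0"
  shows "problem_has dlog_order \<mu> p (dlog_order (fnPhi p)) \<and>
    (0 < dlog_order (fnPhi p) \<and> dlog_order (fnPhi p) < \<infinity> \<longrightarrow>
       problem_has dlog_type \<mu> p (dlog_type (fnPhi p)))"
proof -
  have \<mu>: "solves_moment_problem s \<mu>" and prob: "prob_space \<mu>"
    using assms(1) by (auto simp: normalized_hamburger_def)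
  have "s 0 = 1"
    using \<mu> prob_space.prob_space[OF prob] by (auto simp: solves_moment_problem_def)
  \<comment> \<open>Of two distinct solutions at least one differs from \<mu>.\<close>
  obtain \<nu> where \<nu>: "solves_moment_problem s \<nu>" "\<nu> \<noteq> \<mu>"
    using assms(2) unfolding indeterminate_def by metis
  interpret real_distribution \<mu> by (rule real_distribution_of_moment_problem) fact+
  interpret N: real_distribution \<nu> by (rule real_distribution_of_moment_problem) fact+
  interpret indeterminate_system \<mu> p \<nu>
    using \<mu> \<nu> assms(3) N.real_distribution_axioms
    by unfold_locales (auto simp: solves_moment_problem_def)
  have order: "dlog_order f = dlog_order (fnPhi p)" if "f \<in> moment_functions \<mu> p" for f
    using moment_functions_growth[OF that] dlog_order_mono by (intro antisym)
  moreover have "dlog_type f = dlog_type (fnPhi p)"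
    if "f \<in> moment_functions \<mu> p" "0 < dlog_order (fnPhi p)" "dlog_order (fnPhi p) < \<infinity>" for f
    using moment_functions_growth[OF that(1)] that order[OF that(1)]
    by (intro antisym dlog_type_mono) auto
  ultimately show ?thesis by (auto simp: problem_has_def)
qed

end
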